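(* Let $O$ be a nilpotent adjoint orbit of $\mathfrak{sl}_n(\mathbb C)$ whose Jordan partition $(p_1,\dots,p_s)$ of $n$ satisfies $|p_i-p_j|\le1$ for all $1\le i,j\le s$. Then $O$ is conormal. More precisely, let $e\in O$ and let $(h^+,e,f)$ be an $\mathfrak{sl}_2$-triple. Then there exists a Lie subalgebra $\mathfrak s$ of $\mathfrak{sl}_n(\mathbb C)$ such that $\mathfrak s$ is $\operatorname{ad}h^+$-invariant and $\mathfrak{sl}_n(\mathbb C)=\mathfrak g^e\oplus\mathfrak s$.
   Context: Nilpotent orbits of $\mathfrak{sl}_n(\mathbb C)$ correspond to partitions $p_1\ge\dots\ge p_s$ of $n$, given by the Jordan block sizes. $\mathfrak g^e$ denotes the centralizer of $e$. The hypothesis covers partitions of the form $(p^r)$ and $(p^r,(p-1)^s)$; in particular it covers the regular orbit and the spherical orbits $(2^a,1^b)$. *)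

theory Defs
  imports Complex_Main "Jordan_Normal_Form.Jordan_Normal_Form"
begin

definition mtrace :: "complex mat \<Rightarrow> complex" where
  "mtrace A = (\<Sum>i<dim_row A. A $$ (i,i))"

definition lie_bracket :: "complex mat \<Rightarrow> complex mat \<Rightarrow> complex mat" where
  "lie_bracket X Y = X * Y - Y * X"

definition sl :: "nat \<Rightarrow> complex mat set" where
  "sl n = {X. X \<in> carrier_mat n n \<and> mtrace X = 0}"

definition centralizer :: "nat \<Rightarrow> complex mat \<Rightarrow> complex mat set" where
  "centralizer n e = {X \<in> sl n. lie_bracket X e = 0\<^sub>m n n}"

definition lie_subalgebra :: "nat \<Rightarrow> complex mat set \<Rightarrow> bool" where
  "lie_subalgebra n S \<longleftrightarrow> S \<subseteq> sl n \<and> 0\<^sub>m n n \<in> S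
     \<and> (\<forall>X\<in>S. \<forall>Y\<in>S. X + Y \<in> S)
     \<and> (\<forall>c. \<forall>X\<in>S. c \<cdot>\<^sub>m X \<in> S)
     \<and> (\<forall>X\<in>S. \<forall>Y\<in>S. lie_bracket X Y \<in> S)"

definition sl2_triple :: "nat \<Rightarrow> complex mat \<Rightarrow> complex mat \<Rightarrow> complex mat \<Rightarrow> bool" where
  "sl2_triple n h e f \<longleftrightarrow> h \<in> sl n \<and> e \<in> sl n \<and> f \<in> sl n
     \<and> lie_bracket h e = 2 \<cdot>\<^sub>m e \<and> lie_bracket h f = (-2) \<cdot>\<^sub>m f \<and> lie_bracket e f = h"

definition nilpotent_mat :: "complex mat \<Rightarrow> bool" where
  "nilpotent_mat A \<longleftrightarrow> (\<exists>k. A ^\<^sub>m k = 0\<^sub>m (dim_row A) (dim_col A))"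

definition direct_sum_decomp :: "nat \<Rightarrow> complex mat set \<Rightarrow> complex mat set \<Rightarrow> bool" where
  "direct_sum_decomp n A B \<longleftrightarrow>
     (\<forall>X\<in>sl n. \<exists>!p. fst p \<in> A \<and> snd p \<in> B \<and> X = fst p + snd p)"

end

theory Submission
  imports Defs
begin

text \<open>
  Let \<open>d + 1\<close> be the largest block size. Complete reducibility for the triple shows that
  \<open>V = im e \<oplus> ker f\<close> and \<open>V = im (f ^ d) \<oplus> ker (e ^ d)\<close>, so the space \<open>L = ker f\<close> of lowest weight
  vectors is the sum of its parts \<open>A = im (f ^ d)\<close> of weight \<open>- d\<close> and \<open>L \<inter> ker (e ^ d)\<close>. As every
  block has size \<open>d\<close> or \<open>d + 1\<close>, an endomorphism commuting with \<open>e\<close> is the same as a linear map from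
  \<open>L\<close> to \<open>V\<close> that sends \<open>L \<inter> ker (e ^ d)\<close> into \<open>ker (e ^ d)\<close>. The endomorphisms that kill \<open>A\<close> and map
  \<open>L \<inter> ker (e ^ d)\<close> into \<open>A\<close> therefore complement the centralizer; they form an associative
  algebra normalized by \<open>h\<close>. Removing traces carries this from \<open>gl n\<close> to \<open>sl n\<close>.
\<close>

section \<open>Triples in a ring\<close>

text \<open>Representation theory is replaced by identities in a ring whose nonzero integers are
  invertible. A ring element \<open>x\<close>, acted on from the left, stands for a family of
  vectors, and a splitting is given by an idempotent: \<open>Q\<close> for L along im e,
  \<open>P\<close> for A along ker (e ^ d). With no basis and no dimension at hand, weights enter
  only through annihilating products \<open>lin_prod\<close> of integer linear factors, repeated
  roots allowed: if two such products without a common root kill \<open>x\<close>, then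
  \<open>x = 0\<close>. The condition on the blocks enters where a map on L is extended to an
  element commuting with e. A lowest weight vector of a block of size s must go to a vector killed
  by e ^ s. For s = d + 1 this is automatic, and for s = d it is the single condition of landing in
  ker (e ^ d), whose complement A is at hand. So the part of a map that cannot be extended is
  collected in values in A. Two such parts compose to zero on L because each of them kills
  A.\<close>

definition lin_prod :: "'a::ring_1 \<Rightarrow> int list \<Rightarrow> 'a" where
  "lin_prod a cs = prod_list (map (\<lambda>c. a - of_int c) cs)"

lemma lin_prod_Nil [simp]: "lin_prod a [] = 1"
  and lin_prod_Cons [simp]: "lin_prod a (c # cs) = (a - of_int c) * lin_prod a cs"
  and lin_prod_append: "lin_prod a (cs @ ds) = lin_prod a cs * lin_prod a ds"
  by (simp_all add: lin_prod_def)

text \<open>The guards rank numerals before \<open>of_nat\<close> before \<open>of_int\<close>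
  before all other factors, so that these commutation rules terminate when used for
  rewriting.\<close>

lemma mult_central_commute:
  fixes x y :: "'a::ring_1"
  shows "NO_MATCH (numeral a) x \<Longrightarrow> x * numeral k = numeral k * x"
    and "NO_MATCH (numeral a) x \<Longrightarrow> x * (numeral k * y) = numeral k * (x * y)"
    and "NO_MATCH (numeral a) x \<Longrightarrow> NO_MATCH (of_nat b) x \<Longrightarrow> x * of_nat m = of_nat m * x"
    and "NO_MATCH (numeral a) x \<Longrightarrow> NO_MATCH (of_nat b) x \<Longrightarrow> x * (of_nat m * y) = of_nat m * (x * y)"
    and "NO_MATCH (numeral a) x \<Longrightarrow> NO_MATCH (of_nat b) x \<Longrightarrow> NO_MATCH (of_int c) x \<Longrightarrow>
      x * of_int i = of_int i * x"
    and "NO_MATCH (numeral a) x \<Longrightarrow> NO_MATCH (of_nat b) x \<Longrightarrow> NO_MATCH (of_int c) x \<Longrightarrow>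
      x * (of_int i * y) = of_int i * (x * y)"
proof -
  have k: "x * numeral k = numeral k * x" for x :: 'a and k
    using mult_of_int_commute[of "numeral k" x] by simp
  have m: "x * of_nat m = of_nat m * x" for x :: 'a and m
    using mult_of_nat_commute[of m x] by simp
  have i: "x * of_int i = of_int i * x" for x :: 'a and i
    using mult_of_int_commute[of i x] by simp
  show "x * numeral k = numeral k * x" "x * of_nat m = of_nat m * x" "x * of_int i = of_int i * x"
    by (fact k m i)+
  show "x * (numeral k * y) = numeral k * (x * y)" "x * (of_nat m * y) = of_nat m * (x * y)"
    "x * (of_int i * y) = of_int i * (x * y)"
    by (simp_all only: mult.assoc[symmetric] k[of x] m[of x] i[of x])
qed

lemma mult_of_int_left: "x * (of_int k * y) = of_int k * (x * y)" for x y :: "'a::ring_1"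
  by (metis mult.assoc mult_of_int_commute)

lemma lin_prod_intertwine:
  assumes "a * x = x * (a + of_int d)"
  shows "lin_prod a cs * x = x * lin_prod a (map (\<lambda>c. c - d) cs)"
proof (induction cs)
  case (Cons c cs)
  have "(a - of_int c) * x = x * (a - of_int (c - d))"
    using assms by (simp add: algebra_simps mult_of_int_commute)
  then show ?case
    using Cons by simp (metis mult.assoc)
qed simp

lemma lin_prod_commute:
  assumes "a * x = x * a"
  shows "lin_prod a cs * x = x * lin_prod a cs"
  using lin_prod_intertwine[of a x 0 cs] assms by simp

lemma lin_prod_eigen:
  assumes "a * x = of_int l * x"
  shows "lin_prod a cs * x = of_int (\<Prod>c\<leftarrow>cs. l - c) * x"
proof (induction cs)
  case (Cons c cs)
  have "lin_prod a (c # cs) * x = lin_prod a cs * ((a - of_int c) * x)"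
    using lin_prod_commute[of a "a - of_int c" cs]
    by (simp add: algebra_simps mult_central_commute) (metis mult.assoc)
  also have "(a - of_int c) * x = of_int (l - c) * x"
    using assms by (simp add: algebra_simps)
  also have "lin_prod a cs * (of_int (l - c) * x) = of_int (l - c) * (lin_prod a cs * x)"
    by (rule mult_of_int_left)
  finally show ?case
    by (simp add: Cons mult.assoc)
qed simp

lemma lin_prod_uminus:
  "lin_prod (- a) cs = (- 1) ^ length cs * lin_prod a (map uminus cs)"
proof (induction cs)
  case (Cons c cs)
  have "(- a - of_int c) * y = - ((a + of_int c) * y)" for y
    by (simp add: algebra_simps)
  then show ?case
    using Cons by (cases "even (length cs)") simp_all
qed simp

text \<open>Division with remainder by the variable: \<open>k\<close> is the product of the negated
  roots, and \<open>u\<close> is a polynomial in \<open>a\<close>, of which only its commuting with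
  the commutant of \<open>a\<close> is recorded.\<close>

lemma lin_prod_split:
  assumes "0 \<notin> set cs"
  shows "\<exists>u k. lin_prod a cs = a * u + of_int k \<and> k \<noteq> 0 \<and> (\<forall>x. a * x = x * a \<longrightarrow> u * x = x * u)"
  using assms
proof (induction cs)
  case Nil
  show ?case by (rule exI[of _ 0], rule exI[of _ 1]) simp
next
  case (Cons c cs)
  then obtain u k where u: "lin_prod a cs = a * u + of_int k" "k \<noteq> 0"
    and comm: "\<And>x. a * x = x * a \<Longrightarrow> u * x = x * u" by auto
  define v where "v = (a - of_int c) * u + of_int k"
  have "lin_prod a (c # cs) = a * v + of_int (- c * k)"
    by (simp add: u v_def algebra_simps mult_central_commute)
  moreover have "v * x = x * v" if x: "a * x = x * a" for x
  proof -
    have "a * (u * x) = x * (a * u)"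
      by (simp add: comm[OF x] x flip: mult.assoc)
    then show ?thesis
      by (simp add: v_def algebra_simps mult_central_commute comm[OF x])
  qed
  ultimately show ?case
    using Cons.prems u(2) by (intro exI[of _ v] exI[of _ "- c * k"]) auto
qed

text \<open>The last axiom stands for characteristic zero: it allows the integer constants of weight
  computations to be cancelled.\<close>

locale sl2 =
  fixes e f h :: "'a::ring_1"
  assumes he: "h * e - e * h = 2 * e"
    and hf: "h * f - f * h = - (2 * f)"
    and ef: "e * f - f * e = h"
    and nat_invertible: "\<And>k. \<exists>y::'a. of_nat (Suc k) * y = 1"
begin

lemma int_invertible:
  assumes "c \<noteq> 0"
  obtains y :: 'a where "of_int c * y = 1" "\<And>x. y * x = x * y"
proof -
  obtain z :: 'a where z: "of_nat (Suc (nat \<bar>c\<bar> - 1)) * z = 1"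
    using nat_invertible by blast
  have "int (Suc (nat \<bar>c\<bar> - 1)) = \<bar>c\<bar>"
    using assms by auto
  then have z: "of_int \<bar>c\<bar> * z = 1"
    using z by (metis of_int_of_nat_eq)
  define y where "y = of_int (sgn c) * z"
  have y: "of_int c * y = 1"
    using z by (simp add: y_def abs_sgn mult.assoc)
  have "y * x = x * y" for x
  proof -
    have "x * y = (y * of_int c) * (x * y)"
      by (metis y mult_1 mult_of_int_commute)
    also have "\<dots> = y * x * (of_int c * y)"
      by (metis mult.assoc mult_of_int_commute)
    finally show ?thesis
      by (simp add: y)
  qed
  with y that show thesis by blast
qed

lemma int_cancel:
  assumes "of_int c * x = (0::'a)" "c \<noteq> 0"
  shows "x = 0"
  using int_invertible[OF assms(2)] assms(1) by (metis mult.assoc mult_1 mult_zero_right)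

lemma flip: "sl2 f e (- h)"
proof
  show "- h * f - f * - h = 2 * f"
    using hf by (simp add: algebra_simps)
  show "- h * e - e * - h = - (2 * e)"
    using he by (simp add: algebra_simps)
  show "f * e - e * f = - h"
    using ef by (simp add: algebra_simps)
qed (rule nat_invertible)

text \<open>Replaces the independence of generalized eigenspaces. Peeling off one root
  \<open>c\<close> leaves an eigenvector, on which the other product acts as an integer; this is
  nonzero since \<open>c\<close> is not in \<open>ds\<close>, hence can be cancelled.\<close>

lemma lin_prod_coprime:
  fixes a x :: 'a
  assumes "lin_prod a cs * x = 0" "lin_prod a ds * x = 0" "set cs \<inter> set ds = {}"
  shows "x = 0"
  using assms
proof (induction cs arbitrary: x)
  case (Cons c cs)
  have comm: "lin_prod a bs * ((a - of_int c) * x) = (a - of_int c) * (lin_prod a bs * x)" for bs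
    using lin_prod_commute[of a "a - of_int c" bs]
    by (simp add: algebra_simps mult_central_commute) (metis mult.assoc)
  have "(a - of_int c) * x = 0"
  proof (rule Cons.IH)
    show "lin_prod a cs * ((a - of_int c) * x) = 0"
      using Cons.prems(1) comm by (simp add: mult.assoc)
    show "lin_prod a ds * ((a - of_int c) * x) = 0"
      using Cons.prems(2) comm by simp
  qed (use Cons.prems in auto)
  then have "a * x = of_int c * x"
    by (simp add: algebra_simps)
  then have "of_int (\<Prod>d\<leftarrow>ds. c - d) * x = 0"
    using lin_prod_eigen Cons.prems(2) by metis
  moreover have "(\<Prod>d\<leftarrow>ds. c - d) \<noteq> 0"
    using Cons.prems(3) by (auto simp: prod_list_zero_iff)
  ultimately show ?case
    by (rule int_cancel)
qed simp

section \<open>Commutation with powers, integrality of weights, nilpotency of f\<close>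

lemma h_e_power: "h * e ^ k = e ^ k * (h + of_int (2 * int k))"
proof (induction k)
  case (Suc k)
  have "h * e ^ Suc k = e ^ k * (h + of_int (2 * int k)) * e"
    using Suc by (metis mult.assoc power_Suc2)
  also have "\<dots> = e ^ k * (h * e + e * of_int (2 * int k))"
    by (simp only: mult.assoc distrib_right mult_of_int_commute)
  also have "h * e = e * h + e * 2"
    using he by (simp add: algebra_simps mult_2 mult_2_right)
  finally show ?case
    unfolding power_Suc2 by (simp add: algebra_simps)
qed simp

lemma h_f_power: "h * f ^ k = f ^ k * (h + of_int (- 2 * int k))"
proof -
  have "- h * f ^ k = f ^ k * (- h + of_int (2 * int k))"
    by (rule sl2.h_e_power[OF flip])
  then have "- (h * f ^ k) = - (f ^ k * (h + of_int (- 2 * int k)))"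
    by (simp add: algebra_simps)
  then show ?thesis
    by simp
qed

lemma e_power_f: "e ^ Suc m * f = f * e ^ Suc m + of_int (int (Suc m)) * (e ^ m * (h + of_int (int m)))"
proof (induction m)
  case 0
  then show ?case using ef by (simp add: algebra_simps)
next
  case (Suc m)
  have "e ^ Suc (Suc m) * f = e * (e ^ Suc m * f)"
    by (simp add: mult.assoc)
  also have "\<dots> = e * f * e ^ Suc m + of_int (int (Suc m)) * (e ^ Suc m * (h + of_int (int m)))"
    unfolding Suc by (simp only: mult.assoc power_Suc distrib_left mult_of_int_left[of e])
  also have "e * f = f * e + h"
    using ef by (simp add: algebra_simps)
  also have "(f * e + h) * e ^ Suc m = f * e ^ Suc (Suc m) + e ^ Suc m * (h + of_int (2 * int (Suc m)))"
    unfolding distrib_right h_e_power by (simp add: mult.assoc)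
  also have "f * e ^ Suc (Suc m) + e ^ Suc m * (h + of_int (2 * int (Suc m)))
      + of_int (int (Suc m)) * (e ^ Suc m * (h + of_int (int m)))
    = f * e ^ Suc (Suc m) + of_int (int (Suc (Suc m))) * (e ^ Suc m * (h + of_int (int (Suc m))))"
  proof -
    define x where "x = e ^ Suc m"
    have c: "x * (h + of_int k) = x * h + of_int k * x" for k
      by (simp add: distrib_left mult_of_int_commute)
    show ?thesis
      unfolding x_def[symmetric] c by (simp add: algebra_simps) (simp add: mult_2 distrib_left)
  qed
  finally show ?case .
qed

lemma f_power_e: "f ^ Suc m * e = e * f ^ Suc m + of_int (int (Suc m)) * (f ^ m * (- h + of_int (int m)))"
  by (rule sl2.e_power_f[OF flip])

text \<open>Trades a power of \<open>e\<close> for more roots. Multiplication by \<open>f\<close> on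
  the right raises the roots by 2; a further factor \<open>lin_prod h cs\<close> kills the term
  still containing \<open>e ^ Suc m\<close>, and what remains is \<open>e ^ m\<close> times a
  product in \<open>h\<close>.\<close>

lemma h_annihilated_aux:
  assumes "e ^ m * lin_prod h cs = 0"
  shows "\<exists>ds. lin_prod h ds = 0"
  using assms
proof (induction m arbitrary: cs)
  case (Suc m)
  let ?q = "lin_prod h cs" and ?r = "lin_prod h (map (\<lambda>c. c + 2) cs)"
  have "?q * f = f * ?r"
    using lin_prod_intertwine[of h f "-2" cs] h_f_power[of 1] by simp
  then have "e ^ Suc m * f * ?r = 0"
    using Suc.prems by (metis mult.assoc mult_zero_left)
  then have "(f * e ^ Suc m + of_int (int (Suc m)) * (e ^ m * (h + of_int (int m)))) * ?r * ?q = 0"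
    unfolding e_power_f by simp
  moreover have rq: "?r * ?q = ?q * ?r"
    using lin_prod_commute[of h ?r cs] lin_prod_commute[of h h] by metis
  then have "f * e ^ Suc m * ?r * ?q = 0"
    using Suc.prems by (simp only: mult.assoc) (metis mult.assoc mult_zero_left mult_zero_right)
  ultimately have "of_int (int (Suc m)) * (e ^ m * ((h + of_int (int m)) * ?r * ?q)) = 0"
    by (simp only: distrib_right mult.assoc add_0)
  then have "e ^ m * ((h + of_int (int m)) * ?r * ?q) = 0"
    by (rule int_cancel) simp
  then have "e ^ m * lin_prod h (- int m # map (\<lambda>c. c + 2) cs @ cs) = 0"
    by (simp add: lin_prod_append mult.assoc)
  then show ?case
    by (rule Suc.IH)
qed auto

lemma h_annihilated:
  assumes "e ^ m = 0"
  obtains cs where "lin_prod h cs = 0"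
  using h_annihilated_aux[of m "[]"] assms by auto

lemma f_nilpotent:
  assumes "e ^ m = 0"
  shows "\<exists>k. f ^ k = 0"
proof -
  obtain cs where cs: "lin_prod h cs = 0"
    using h_annihilated assms by blast
  \<comment> \<open>\<open>f ^ k\<close> lowers weights by 2 k, which exceeds the distance between
    any two roots, so the shifted roots miss the old ones.\<close>
  define k where "k = nat (Max (insert 0 (abs ` set cs))) + 1"
  have bound: "\<bar>c\<bar> < int k" if "c \<in> set cs" for c
  proof -
    have "\<bar>c\<bar> \<le> Max (insert 0 (abs ` set cs))"
      using that by (intro Max_ge) auto
    then show ?thesis
      by (simp add: k_def)
  qed
  have "f ^ k = 0"
  proof (rule lin_prod_coprime)
    show "lin_prod h cs * f ^ k = 0"
      by (simp add: cs)
    have "lin_prod h (map (\<lambda>c. c - 2 * int k) cs) * f ^ k = f ^ k * lin_prod h cs"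
      by (subst lin_prod_intertwine[OF h_f_power]) (simp add: o_def)
    then show "lin_prod h (map (\<lambda>c. c - 2 * int k) cs) * f ^ k = 0"
      by (simp add: cs)
    have "c - 2 * int k \<notin> set cs" if "c \<in> set cs" for c
      using bound[OF that] bound[of "c - 2 * int k"] by auto
    then show "set cs \<inter> set (map (\<lambda>c. c - 2 * int k) cs) = {}"
      by auto
  qed
  then show ?thesis ..
qed

text \<open>The constant is the product of (i + 1) (d - i) over i < j, so it vanishes only beyond
  the bottom of the string.\<close>

lemma highest_weight_string:
  assumes "e * x = 0" "h * x = of_int (int d) * x" "j \<le> d"
  shows "\<exists>c. c \<noteq> 0 \<and> e ^ j * f ^ j * x = of_int c * x"
  using assms(3)
proof (induction j)
  case 0
  show ?case by (rule exI[of _ 1]) simp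
next
  case (Suc j)
  then obtain c where c: "c \<noteq> 0" "e ^ j * f ^ j * x = of_int c * x" by auto
  let ?k = "int (Suc j) * (int d - int j)"
  have "(- h + of_int (int j)) * x = of_int (int j - int d) * x"
    using assms(2) by (simp add: algebra_simps)
  moreover have "e * f ^ Suc j * x = f ^ Suc j * (e * x) - of_int (int (Suc j)) * (f ^ j * ((- h + of_int (int j)) * x))"
    using arg_cong[OF f_power_e[of j], of "\<lambda>y. y * x"] by (simp only: distrib_right mult.assoc) simp
  ultimately have "e * f ^ Suc j * x = - (of_int (int (Suc j)) * (f ^ j * (of_int (int j - int d) * x)))"
    using assms(1) by (simp only: mult_zero_right diff_0)
  also have "f ^ j * (of_int (int j - int d) * x) = of_int (int j - int d) * (f ^ j * x)"
    by (rule mult_of_int_left)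
  also have "- (of_int (int (Suc j)) * (of_int (int j - int d) * (f ^ j * x))) = of_int ?k * (f ^ j * x)"
  proof -
    have "?k = - (int (Suc j) * (int j - int d))"
      by (simp add: algebra_simps)
    then show ?thesis
      by (simp only: of_int_minus of_int_mult mult_minus_left mult.assoc)
  qed
  finally have "e * f ^ Suc j * x = of_int ?k * (f ^ j * x)" .
  then have "e ^ Suc j * f ^ Suc j * x = e ^ j * (of_int ?k * (f ^ j * x))"
    unfolding power_Suc2[of e] by (simp only: mult.assoc)
  also have "\<dots> = of_int ?k * (of_int c * x)"
    using c(2) by (simp only: mult_of_int_left[of "e ^ j"] mult.assoc)
  finally have "e ^ Suc j * f ^ Suc j * x = of_int (?k * c) * x"
    by (simp only: of_int_mult mult.assoc)
  moreover have "?k * c \<noteq> 0"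
    using c(1) Suc.prems by auto
  ultimately show ?case by blast
qed

text \<open>The image of \<open>e ^ d\<close> consists of highest weight vectors of weight d: moving
  \<open>f\<close> past the vanishing \<open>e ^ Suc d\<close> forces
  \<open>e ^ d * (h + d) = 0\<close>, and moving \<open>h\<close> to the left turns -d into
  d.\<close>

lemma e_power_top:
  assumes "e ^ Suc d = 0"
  shows "\<exists>c. c \<noteq> 0 \<and> e ^ d * f ^ d * e ^ d = of_int c * e ^ d"
proof -
  have "of_int (int (Suc d)) * (e ^ d * (h + of_int (int d))) = 0"
    using e_power_f[of d] unfolding assms by simp
  then have "e ^ d * (h + of_int (int d)) = 0"
    by (rule int_cancel) simp
  moreover have "h * e ^ d = e ^ d * (h + of_int (int d)) + e ^ d * of_int (int d)"
    unfolding h_e_power mult_2 of_int_add by (simp only: distrib_left add.assoc)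
  ultimately have "h * e ^ d = e ^ d * of_int (int d)"
    by simp
  then have "h * e ^ d = of_int (int d) * e ^ d"
    unfolding mult_of_int_commute .
  moreover have "e * e ^ d = 0"
    using assms unfolding power_Suc .
  ultimately show ?thesis
    using highest_weight_string[of "e ^ d" d d] by blast
qed

text \<open>If the last nonzero power \<open>f ^ r\<close> had r > d, the flipped triple would make
  \<open>f ^ r * e ^ r * f ^ r\<close> a nonzero integer multiple of \<open>f ^ r\<close>, although
  \<open>e ^ r = 0\<close>.\<close>

lemma f_power_eq_0:
  assumes "e ^ Suc d = 0"
  shows "f ^ Suc d = 0"
proof (rule ccontr)
  assume nz: "f ^ Suc d \<noteq> 0"
  define q where "q = (LEAST k. f ^ k = 0)"
  have q: "f ^ q = 0"
    unfolding q_def using f_nilpotent[OF assms] by (rule LeastI_ex)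
  have "Suc d < q"
  proof (rule ccontr)
    assume "\<not> Suc d < q"
    then have "f ^ Suc d = f ^ q * f ^ (Suc d - q)"
      by (simp flip: power_add)
    with q nz show False by simp
  qed
  then obtain r where r: "q = Suc r" "Suc d \<le> r"
    by (cases q) auto
  have "f ^ r \<noteq> 0"
    using not_less_Least[of r "\<lambda>k. f ^ k = 0"] r by (auto simp: q_def[symmetric])
  moreover obtain c where "c \<noteq> 0" "f ^ r * e ^ r * f ^ r = of_int c * f ^ r"
    using sl2.e_power_top[OF flip] q r by blast
  moreover have "e ^ r = e ^ Suc d * e ^ (r - Suc d)"
    using r(2) by (simp only: le_add_diff_inverse flip: power_add)
  ultimately show False
    using assms int_cancel[of c "f ^ r"] by simp
qed

section \<open>The eigenvalues of f e and the splitting into im e and ker f\<close>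

lemma h_fe_commute: "h * (f * e) = f * e * h"
proof -
  have "h * (f * e) = (h * f) * e"
    by (simp only: mult.assoc)
  also have "h * f = f * (h - 2)"
    using h_f_power[of 1] by simp
  also have "f * (h - 2) * e = f * (h * e) - f * (2 * e)"
    by (simp add: algebra_simps)
  also have "h * e = e * h + 2 * e"
    using he by (simp add: algebra_simps)
  finally show ?thesis
    by (simp add: algebra_simps)
qed

text \<open>Highest weights are nonnegative, with \<open>f * e * x = 0\<close> in place of
  \<open>e * x = 0\<close>. Moving \<open>e\<close> past \<open>f ^ Suc m\<close> shows that
  \<open>h - m\<close> maps \<open>x\<close> to something already killed by
  \<open>f ^ m\<close>.\<close>

lemma lowering_weights:
  assumes "f * e * x = 0" "f ^ m * x = 0"
  shows "lin_prod h (map int [0..<m]) * x = 0"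
  using assms
proof (induction m arbitrary: x)
  case (Suc m)
  let ?y = "(h - of_int (int m)) * x"
  have "f ^ Suc m * e * x = f ^ m * (f * e * x)"
    by (simp only: power_Suc2 mult.assoc)
  then have "of_int (int (Suc m)) * (f ^ m * (- h + of_int (int m)) * x) = 0"
    using Suc.prems unfolding f_power_e by (simp only: distrib_right mult.assoc) simp
  then have "f ^ m * (- h + of_int (int m)) * x = 0"
    by (rule int_cancel) simp
  then have "f ^ m * ?y = 0"
    by (simp add: algebra_simps)
  moreover have "f * e * (h - of_int (int m)) = (h - of_int (int m)) * (f * e)"
    using h_fe_commute by (simp add: algebra_simps mult_central_commute)
  then have "f * e * ?y = 0"
    using Suc.prems(1) by (metis mult.assoc mult_zero_right)
  ultimately have "lin_prod h (map int [0..<m]) * ?y = 0"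
    by (intro Suc.IH)
  then show ?case
    by (simp add: lin_prod_append mult.assoc)
qed simp

text \<open>The weights of \<open>e * x\<close> are at least 2, being those of \<open>x\<close>
  raised by 2, and at most 0, since \<open>f\<close> kills \<open>e * x\<close>. In other words, im
  e and ker f meet only in 0.\<close>

lemma fe_cancel:
  assumes "e ^ m = 0" "f ^ m = 0" "f * e * x = 0"
  shows "e * x = 0"
proof (rule lin_prod_coprime)
  have "lin_prod h (map (\<lambda>c. c - (-2)) (map int [0..<m])) * e * x = 0"
  proof -
    have "h * e = e * (h + of_int 2)"
      using h_e_power[of 1] by simp
    then have "lin_prod h (map (\<lambda>c. c - (-2)) (map int [0..<m])) * e = e * lin_prod h (map int [0..<m])"
      by (subst lin_prod_intertwine[of h e 2]) (auto simp: o_def)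
    then show ?thesis
      using lowering_weights[of x m] assms by (metis mult.assoc mult_zero_left mult_zero_right)
  qed
  then show "lin_prod h (map (\<lambda>c. c - (-2)) (map int [0..<m])) * (e * x) = 0"
    by (simp only: mult.assoc)
  have "lin_prod (- h) (map int [0..<m]) * (e * x) = 0"
    using assms by (intro sl2.lowering_weights[OF flip]) (simp_all add: mult.assoc flip: mult.assoc[of "e ^ m"])
  then have "(- 1) ^ m * (lin_prod h (map uminus (map int [0..<m])) * (e * x)) = 0"
    by (simp add: lin_prod_uminus mult.assoc)
  then show "lin_prod h (map uminus (map int [0..<m])) * (e * x) = 0"
    by (cases "even m") simp_all
qed auto

text \<open>A vector of weight l lying j steps below the top of its string is multiplied by j (l + j
  + 1) under \<open>f * e\<close>, and \<open>e ^ k * x = 0\<close> bounds j by k - 1. The induction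
  removes the largest j first.\<close>

lemma eigen_annihilator:
  assumes "h * x = of_int l * x" "e ^ k * x = 0"
  shows "lin_prod (f * e) (map (\<lambda>j. int j * (l + int j + 1)) [0..<k]) * x = 0"
  using assms
proof (induction k arbitrary: x)
  case (Suc k)
  define c where "c = int k * (l + int k + 1)"
  let ?y = "(f * e - of_int c) * x"
  have "h * ?y = of_int l * ?y"
  proof -
    have "h * (f * e - of_int c) = (f * e - of_int c) * h"
      using h_fe_commute by (simp add: left_diff_distrib right_diff_distrib mult_of_int_commute)
    then have "h * ?y = (f * e - of_int c) * (h * x)"
      by (metis mult.assoc)
    then show ?thesis
      unfolding Suc.prems(1) by (simp only: mult_of_int_left[of "f * e - of_int c"])
  qed
  moreover have "e ^ k * ?y = 0"
  proof (cases k)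
    case 0
    then show ?thesis
      using Suc.prems(2) by (simp add: c_def left_diff_distrib mult.assoc)
  next
    case k: (Suc m)
    have "h * e = e * h + 2 * e"
      using he by (simp add: algebra_simps)
    then have "(h + of_int (int m)) * (e * x) = e * (h * x) + of_int (int m + 2) * (e * x)"
      by (simp add: algebra_simps flip: mult.assoc)
    also have "\<dots> = of_int (l + int m + 2) * (e * x)"
      unfolding Suc.prems(1) by (simp add: distrib_right mult_central_commute)
    finally have w: "(h + of_int (int m)) * (e * x) = of_int (l + int m + 2) * (e * x)" .
    have "e ^ k * (f * e * x) = (e ^ Suc m * f) * (e * x)"
      by (simp only: k mult.assoc)
    also have "\<dots> = f * (e ^ Suc k * x) + of_int (int (Suc m)) * (e ^ m * ((h + of_int (int m)) * (e * x)))"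
      unfolding e_power_f by (simp only: k distrib_right mult.assoc power_Suc2)
    also have "\<dots> = of_int (int (Suc m)) * (e ^ m * (of_int (l + int m + 2) * (e * x)))"
      unfolding w Suc.prems(2) by simp
    also have "e ^ m * (of_int (l + int m + 2) * (e * x)) = of_int (l + int m + 2) * (e ^ k * x)"
      unfolding k power_Suc2 by (simp only: mult_of_int_left[of "e ^ m"] mult.assoc)
    also have "of_int (int (Suc m)) * (of_int (l + int m + 2) * (e ^ k * x)) = of_int c * (e ^ k * x)"
    proof -
      have "int (Suc m) * (l + int m + 2) = c"
        by (simp add: k c_def algebra_simps)
      then show ?thesis
        by (simp only: mult.assoc[symmetric] of_int_mult[symmetric])
    qed
    also have "\<dots> = e ^ k * (of_int c * x)"
      by (simp only: mult_of_int_left[of "e ^ k"])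
    finally show ?thesis
      by (simp only: left_diff_distrib right_diff_distrib diff_self)
  qed
  ultimately have "lin_prod (f * e) (map (\<lambda>j. int j * (l + int j + 1)) [0..<k]) * ?y = 0"
    by (rule Suc.IH)
  then show ?case
    by (simp add: lin_prod_append mult.assoc c_def)
qed simp

lemma fe_annihilated:
  assumes "e ^ k = 0"
  obtains cs where "lin_prod (f * e) cs = 0"
proof -
  have "\<exists>cs. \<forall>x. lin_prod h ls * x = 0 \<longrightarrow> lin_prod (f * e) cs * x = 0" for ls
  proof (induction ls)
    case (Cons l ls)
    then obtain cs where cs: "\<And>x. lin_prod h ls * x = 0 \<Longrightarrow> lin_prod (f * e) cs * x = 0"
      by auto
    let ?ds = "map (\<lambda>j. int j * (l + int j + 1)) [0..<k]"
    have "lin_prod (f * e) (?ds @ cs) * x = 0" if x: "lin_prod h (l # ls) * x = 0" for x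
    proof -
      let ?y = "lin_prod (f * e) cs * x"
      have "lin_prod h ls * ((h - of_int l) * x) = 0"
        using x lin_prod_commute[of h "h - of_int l" ls]
        by (simp add: algebra_simps mult_central_commute) (metis mult.assoc)
      then have "lin_prod (f * e) cs * ((h - of_int l) * x) = 0"
        by (rule cs)
      moreover have "lin_prod (f * e) cs * (h - of_int l) = (h - of_int l) * lin_prod (f * e) cs"
        using h_fe_commute
        by (intro lin_prod_commute) (simp add: left_diff_distrib right_diff_distrib mult_of_int_commute)
      ultimately have "(h - of_int l) * ?y = 0"
        by (metis mult.assoc)
      then have "h * ?y = of_int l * ?y"
        by (simp add: algebra_simps)
      then show ?thesis
        using eigen_annihilator[of ?y l k] assms by (simp add: lin_prod_append mult.assoc)
    qed
    then show ?case by blast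
  qed (auto intro: exI[of _ "[]"])
  moreover obtain ls where "lin_prod h ls = 0"
    using h_annihilated assms by blast
  ultimately have "\<exists>cs. lin_prod (f * e) cs * 1 = 0"
    by (metis mult_zero_left)
  with that show thesis by auto
qed

text \<open>As \<open>a * a\<close> has no larger kernel than \<open>a\<close>, the root 0 can be
  reduced to multiplicity one, which makes \<open>a\<close> invertible on its image.\<close>

lemma lin_prod_drop_zeros:
  fixes a x :: 'a
  assumes "\<And>x. a * (a * x) = 0 \<Longrightarrow> a * x = 0" "lin_prod a cs * x = 0"
  shows "a * (lin_prod a (filter (\<lambda>c. c \<noteq> 0) cs) * x) = 0"
  using assms(2)
proof (induction cs arbitrary: x)
  case (Cons c cs)
  let ?y = "(a - of_int c) * x"
  have comm: "lin_prod a bs * ?y = (a - of_int c) * (lin_prod a bs * x)" for bs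
    using lin_prod_commute[of a "a - of_int c" bs]
    by (simp add: algebra_simps mult_central_commute) (metis mult.assoc)
  have "a * (lin_prod a (filter (\<lambda>c. c \<noteq> 0) cs) * ?y) = 0"
    using Cons.prems comm by (intro Cons.IH) (simp add: mult.assoc)
  then show ?case
    using comm assms(1) by (auto simp: mult.assoc)
qed simp

text \<open>The factor \<open>e * w * f\<close> is the projection onto the image of \<open>e\<close> along the kernel of \<open>f\<close>.\<close>

lemma quasi_inverse:
  assumes "e ^ m = 0" "f ^ m = 0"
  obtains w where "f * e * w * f = f" "e * w * f * e = e" "h * w = w * h"
proof -
  note e_cancel = fe_cancel[OF assms]
  have f_cancel: "f * x = 0" if "e * f * x = 0" for x
    using sl2.fe_cancel[OF flip, of m] assms that by blast
  obtain cs where "lin_prod (f * e) cs = 0"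
    using fe_annihilated[OF assms(1)] .
  moreover have "f * e * x = 0" if "f * e * (f * e * x) = 0" for x
  proof -
    have "e * (f * e * x) = 0"
      using that by (intro e_cancel) (simp add: mult.assoc)
    then have "f * (e * x) = 0"
      by (intro f_cancel) (simp add: mult.assoc)
    then show ?thesis by (simp add: mult.assoc)
  qed
  ultimately have *: "f * e * lin_prod (f * e) (filter (\<lambda>c. c \<noteq> 0) cs) = 0"
    using lin_prod_drop_zeros[of "f * e" cs 1] by simp
  obtain u k where u: "lin_prod (f * e) (filter (\<lambda>c. c \<noteq> 0) cs) = f * e * u + of_int k"
    and "k \<noteq> 0" and comm: "\<And>x. f * e * x = x * (f * e) \<Longrightarrow> u * x = x * u"
    using lin_prod_split[of "filter (\<lambda>c. c \<noteq> 0) cs" "f * e"] by auto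
  obtain y :: 'a where y: "of_int k * y = 1" "\<And>x. y * x = x * y"
    using int_invertible[OF \<open>k \<noteq> 0\<close>] by blast
  \<comment> \<open>By \<open>*\<close>, \<open>f * e * (f * e * u + k) = 0\<close>, so - u / k
    inverts \<open>f * e\<close> on its image; \<open>y\<close> is 1 / k.\<close>
  define w where "w = - (u * y)"
  have w_comm: "w * x = x * w" if "f * e * x = x * (f * e)" for x
    using comm[OF that] y(2) by (simp add: w_def) (metis mult.assoc)
  have "f * e * (f * e * w - 1) = - (f * e * (f * e * u + of_int k)) * y"
    using y(1) by (simp add: w_def algebra_simps)
  then have "f * e * (f * e * w - 1) = 0"
    using * u by simp
  then have "e * (f * e * w - 1) = 0"
    by (rule e_cancel)
  then have 1: "e * f * e * w = e"
    by (simp add: algebra_simps)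
  have "e * f * (e * w * f - 1) = (e * f * e * w) * f - e * f"
    by (simp only: right_diff_distrib mult.assoc mult_1_right)
  then have "f * (e * w * f - 1) = 0"
    unfolding 1 by (intro f_cancel) simp
  then have "f * e * w * f = f"
    by (simp add: algebra_simps)
  moreover have "e * w * f * e = e"
    using 1 w_comm[of "f * e"] by (simp add: mult.assoc)
  moreover have "h * w = w * h"
    using w_comm[of h] h_fe_commute by simp
  ultimately show thesis by (rule that)
qed

section \<open>Centralizer elements with prescribed values on lowest weight vectors\<close>

text \<open>\<open>Q\<close> is the projection along im e onto ker g, and \<open>R\<close> projects
  onto ker e within the factor cut out by \<open>u\<close>. The map to be extended is
  \<open>z\<close>, given on im Q.\<close>

lemma extend_to_centralizer:
  fixes g u Q R z :: 'a
  assumes top: "e ^ Suc d = 0"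
    and Q: "Q = 1 - e * g" "Q * e = 0" "g * Q = 0"
    and u: "\<And>x. u * x = x * u" "u * u = u"
    and R: "R = u * (1 - g * e)"
    and image: "\<And>x. e ^ (d - 1) * x = 0 \<Longrightarrow> u * x = x \<Longrightarrow> \<exists>y. x = e * y"
    and z: "z * Q = z" "z * u = z" "\<And>x. e ^ d * x = 0 \<Longrightarrow> e ^ d * z * x = 0"
  shows "\<exists>c. c * e = e * c \<and> c * Q = z"
proof -
  \<comment> \<open>Iterating \<open>x = Q * x + e * g * x\<close> expands \<open>x\<close> as the
    sum of the \<open>e ^ i * Q * g ^ i * x\<close>, so an element that commutes with
    \<open>e\<close> and restricts to \<open>z\<close> must be this sum.\<close>
  define c where "c = (\<Sum>i<Suc d. e ^ i * z * g ^ i)"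
  have uR: "u * (x * R) = x * R" for x
    unfolding R by (metis u mult.assoc)
  have ker: "e ^ Suc i * g ^ i * R = 0" if "i < d" for i
    using that
  proof (induction i)
    case 0
    have "e * (1 - g * e) = Q * e"
      by (simp add: Q(1) algebra_simps)
    then have "e * (1 - g * e) = 0"
      using Q(2) by simp
    then have "e * R = 0"
      unfolding R u(1) by (simp flip: mult.assoc)
    then show ?case by simp
  next
    case (Suc i)
    then have *: "e ^ Suc i * g ^ i * R = 0" by simp
    have "d - 1 = (d - 1 - Suc i) + Suc i"
      using Suc.prems by simp
    then have "e ^ (d - 1) = e ^ (d - 1 - Suc i) * e ^ Suc i"
      by (metis power_add)
    then have "e ^ (d - 1) * (g ^ i * R) = 0"
      using * by (simp add: mult.assoc)
    then obtain y where "g ^ i * R = e * y"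
      using image uR by blast
    then have "Q * (g ^ i * R) = 0"
      using Q(2) by (simp flip: mult.assoc)
    then have eg: "e * g * (g ^ i * R) = g ^ i * R"
      unfolding Q(1) by (simp add: left_diff_distrib)
    have "e ^ Suc (Suc i) * g ^ Suc i * R = e ^ Suc i * (e * g * (g ^ i * R))"
      by (simp only: power_Suc2[of e] power_Suc[of g] mult.assoc)
    then show ?case
      unfolding eg using * by (simp add: mult.assoc)
  qed
  \<comment> \<open>The obstruction to commuting with \<open>e\<close> comes from ker e moved down i
    steps by \<open>g\<close>. For i < d - 1 the result lies in im e, where \<open>z\<close>
    vanishes; for i = d - 1 it lies in ker (e ^ d), which \<open>z\<close> preserves.\<close>
  have vanish: "e ^ Suc i * z * g ^ i * R = 0" if i: "i < d" for i
  proof (cases "Suc i = d")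
    case True
    then show ?thesis
      using z(3)[of "g ^ i * R"] ker[OF i] by (simp only: mult.assoc)
  next
    case False
    then have "Q * (g ^ i * R) = 0"
    proof -
      have "d - 1 = (d - 1 - Suc i) + Suc i"
        using i False by simp
      then have "e ^ (d - 1) = e ^ (d - 1 - Suc i) * e ^ Suc i"
        by (metis power_add)
      then have "e ^ (d - 1) * (g ^ i * R) = 0"
        using ker[OF i] by (simp add: mult.assoc)
      then obtain y where "g ^ i * R = e * y"
        using image uR by blast
      then show ?thesis
        using Q(2) by (simp flip: mult.assoc)
    qed
    moreover have "e ^ Suc i * z * g ^ i * R = e ^ Suc i * (z * Q) * g ^ i * R"
      by (simp only: z(1))
    ultimately show ?thesis
      by (simp only: mult.assoc mult_zero_right)
  qed
  have "z * e = 0"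
    using z(1) Q(2) by (metis mult.assoc mult_zero_right)
  have "c * e = z * e + (\<Sum>i<d. e ^ Suc i * z * g ^ Suc i * e)"
    unfolding c_def sum.lessThan_Suc_shift by (simp add: distrib_right sum_distrib_right)
  also have "\<dots> = (\<Sum>i<d. e ^ Suc i * z * g ^ i)"
  proof -
    have "e ^ Suc i * z * g ^ Suc i * e = e ^ Suc i * z * g ^ i" if "i < d" for i
    proof -
      have absorb: "z * (u * x) = z * x" for x
        using z(2) by (simp flip: mult.assoc)
      have "u * (g ^ Suc i * e) = g ^ i * (u - R)"
        unfolding R power_Suc2 by (simp add: right_diff_distrib mult.assoc u(1)[of "g ^ i * (g * e)"] u(1)[of "g * e"])
      then have "z * (g ^ Suc i * e) = z * (g ^ i * u - g ^ i * R)"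
        by (metis absorb right_diff_distrib)
      then have "e ^ Suc i * z * g ^ Suc i * e = e ^ Suc i * (z * (u * g ^ i)) - e ^ Suc i * z * g ^ i * R"
        by (simp only: mult.assoc right_diff_distrib u(1))
      then show ?thesis
        using vanish[OF that] by (simp only: absorb diff_zero mult.assoc)
    qed
    then show ?thesis
      using \<open>z * e = 0\<close> by simp
  qed
  also have "\<dots> = (\<Sum>i<Suc d. e ^ Suc i * z * g ^ i)"
    using top by simp
  also have "\<dots> = e * c"
    unfolding c_def by (simp only: sum_distrib_left power_Suc mult.assoc)
  finally have "c * e = e * c" .
  moreover have "c * Q = z"
  proof -
    have "g ^ Suc i * Q = 0" for i
      unfolding power_Suc2 using Q(3) by (simp add: mult.assoc)
    then have "e ^ Suc i * z * g ^ Suc i * Q = 0" for i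
      by (simp only: mult.assoc mult_zero_right)
    then show ?thesis
      unfolding c_def sum.lessThan_Suc_shift
      by (simp add: distrib_right sum_distrib_right z(1) del: power_Suc)
  qed
  ultimately show ?thesis by blast
qed

text \<open>
  The assumption \<open>jordan\<close> encodes that the kernel of \<open>e ^ (d - 1)\<close> lies in the image of \<open>e\<close>, i.e. that
  no Jordan block is smaller than \<open>d\<close>. In the proof \<open>P\<close> projects onto the weight space of weight
  \<open>- d\<close>, and \<open>B\<close> projects onto the lowest weight vectors of weight \<open>1 - d\<close>. The complement of the
  centralizer consists of the \<open>Y\<close> that kill the former space and map the latter into it. The central
  idempotent \<open>u\<close> allows \<open>e\<close>, \<open>f\<close> and \<open>h\<close> to lie in a direct factor of the ring.
\<close>

theorem centralizer_complement:
  assumes top: "e ^ Suc d = 0"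
    and jordan: "e * a + b * e ^ (d - 1) = u"
    and u: "\<And>x. u * x = x * u" "u * u = u"
  obtains T where "0 \<in> T" "\<And>x y. x \<in> T \<Longrightarrow> y \<in> T \<Longrightarrow> x + y \<in> T"
    and "\<And>x y. x \<in> T \<Longrightarrow> y \<in> T \<Longrightarrow> x * y \<in> T"
    and "\<And>c x. (\<And>y. c * y = y * c) \<Longrightarrow> x \<in> T \<Longrightarrow> c * x \<in> T"
    and "\<And>x. x \<in> T \<Longrightarrow> h * x - x * h \<in> T"
    and "\<And>X. X * u = X \<Longrightarrow> \<exists>C. C * e = e * C \<and> X - C \<in> T"
    and "\<And>Y. Y \<in> T \<Longrightarrow> Y * e = e * Y \<Longrightarrow> Y = 0"
proof -
  have ftop: "f ^ Suc d = 0"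
    by (rule f_power_eq_0[OF top])
  obtain w where w: "f * e * w * f = f" "e * w * f * e = e" "h * w = w * h"
    using quasi_inverse[OF top ftop] .
  define g where "g = w * f"
  define Q where "Q = 1 - e * g"
  have fQ: "f * Q = 0" and Qe: "Q * e = 0" and gQ: "g * Q = 0"
    using w by (simp_all add: Q_def g_def right_diff_distrib left_diff_distrib mult.assoc)
  have QQ: "Q * Q = Q"
    using gQ by (simp add: Q_def[of] left_diff_distrib mult.assoc)
  have hQ: "h * Q = Q * h"
  proof -
    have "h * (e * w * f) = (h * e) * w * f"
      by (simp only: mult.assoc)
    also have "h * e = e * h + 2 * e"
      using he by (simp add: algebra_simps)
    also have "(e * h + 2 * e) * w * f = e * w * (h * f) + 2 * (e * w * f)"
      by (simp add: distrib_right mult.assoc) (simp add: w(3) flip: mult.assoc)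
    also have "h * f = f * h - 2 * f"
      using hf by (simp add: algebra_simps)
    also have "e * w * (f * h - 2 * f) + 2 * (e * w * f) = e * w * f * h"
      by (simp add: right_diff_distrib mult_central_commute mult.assoc)
    finally show ?thesis
      by (simp add: Q_def g_def right_diff_distrib left_diff_distrib mult.assoc)
  qed
  obtain c where c: "c \<noteq> 0" "e ^ d * f ^ d * e ^ d = of_int c * e ^ d"
    using e_power_top[OF top] by blast
  obtain y :: 'a where y: "of_int c * y = 1" "\<And>x. y * x = x * y"
    using int_invertible[OF c(1)] by blast
  \<comment> \<open>Dividing by \<open>c\<close> makes \<open>f ^ d * e ^ d\<close> idempotent; its
    kernel is ker (e ^ d).\<close>
  define P where "P = y * (f ^ d * e ^ d)"
  have eP: "e ^ d * P = e ^ d"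
  proof -
    have "e ^ d * P = y * (e ^ d * f ^ d * e ^ d)"
      unfolding P_def by (metis y(2) mult.assoc)
    also have "\<dots> = of_int c * y * e ^ d"
      unfolding c(2) by (metis y(2) mult.assoc)
    finally show ?thesis
      by (simp add: y(1))
  qed
  have PP: "P * P = P"
  proof -
    have "P * P = y * (f ^ d * (e ^ d * P))"
      by (simp add: P_def mult.assoc)
    then show ?thesis
      unfolding eP by (simp add: P_def)
  qed
  have P_eq_0: "P * x = 0" if "e ^ d * x = 0" for x
    using that by (simp add: P_def mult.assoc)
  have fP: "f * P = 0"
  proof -
    have "f * P = y * (f ^ Suc d * e ^ d)"
      unfolding P_def by (metis y(2) mult.assoc power_Suc)
    then show ?thesis
      unfolding ftop by simp
  qed
  have QP: "Q * P = P"
    using fP by (simp add: Q_def g_def left_diff_distrib mult.assoc)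
  have hP: "h * P = P * h"
  proof -
    have "h * (f ^ d * e ^ d) = f ^ d * (h * e ^ d) - of_int (2 * int d) * (f ^ d * e ^ d)"
    proof -
      have "h * (f ^ d * e ^ d) = f ^ d * (h + of_int (- 2 * int d)) * e ^ d"
        using h_f_power[of d] by (simp flip: mult.assoc)
      also have "\<dots> = f ^ d * (h * e ^ d) + f ^ d * (of_int (- 2 * int d) * e ^ d)"
        by (simp only: distrib_left distrib_right mult.assoc)
      finally show ?thesis
        unfolding mult_of_int_left by simp
    qed
    also have "f ^ d * (h * e ^ d) = f ^ d * e ^ d * h + of_int (2 * int d) * (f ^ d * e ^ d)"
      unfolding h_e_power distrib_left mult_of_int_commute[symmetric] mult_of_int_left by (simp only: mult.assoc)
    finally have "h * (f ^ d * e ^ d) = f ^ d * e ^ d * h"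
      by simp
    then show ?thesis
      unfolding P_def by (metis y(2) mult.assoc)
  qed
  define B where "B = (1 - P) * Q"
  have PB: "P * B = 0"
    by (simp add: B_def left_diff_distrib right_diff_distrib PP flip: mult.assoc)
  have QB: "Q * B = B"
    by (simp add: B_def left_diff_distrib right_diff_distrib QQ QP flip: mult.assoc)
  have BP: "B * P = 0"
    by (simp add: B_def left_diff_distrib right_diff_distrib QP PP mult.assoc)
  have BB: "B * B = B"
    using QB PB by (metis B_def diff_zero left_diff_distrib mult.assoc mult_1)
  have BQ: "B * Q = B"
    by (simp add: B_def mult.assoc QQ)
  have PB_Q: "P * Q + B = Q"
    by (simp add: B_def left_diff_distrib)
  define T where "T = {Y. Y * P = 0 \<and> (1 - P) * Y * B = 0}"
  show thesis
  proof (rule that[of T])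
    show "0 \<in> T" "\<And>x y. x \<in> T \<Longrightarrow> y \<in> T \<Longrightarrow> x + y \<in> T"
      by (simp_all add: T_def distrib_left distrib_right)
  next
    fix x y
    assume "x \<in> T" "y \<in> T"
    then have xy: "x * P = 0" "y * P = 0" "(1 - P) * y * B = 0"
      by (simp_all add: T_def)
    \<comment> \<open>\<open>y\<close> maps im B into im P, which \<open>x\<close> kills.\<close>
    have "y * B = P * (y * B)"
      using xy(3) by (simp add: left_diff_distrib mult.assoc)
    then have "x * y * B = (x * P) * (y * B)"
      by (metis mult.assoc)
    then have "x * y * B = 0"
      by (simp add: xy(1))
    then show "x * y \<in> T"
      using xy(2) by (simp add: T_def mult.assoc)
  next
    fix c x :: 'a
    assume c: "\<And>y. c * y = y * c" and "x \<in> T"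
    then have x: "x * P = 0" "(1 - P) * x * B = 0"
      by (simp_all add: T_def)
    have "(1 - P) * (c * x) * B = c * ((1 - P) * x * B)"
      by (metis c mult.assoc)
    then show "c * x \<in> T"
      by (simp add: T_def x mult.assoc[of c x P])
  next
    fix x
    assume "x \<in> T"
    then have x: "x * P = 0" "(1 - P) * x * B = 0"
      by (simp_all add: T_def)
    have "h * (1 - P) = (1 - P) * h"
      by (simp add: left_diff_distrib right_diff_distrib hP)
    then have hB: "h * B = B * h"
      unfolding B_def by (metis hQ mult.assoc)
    have "(1 - P) * (h * x) * B = h * ((1 - P) * x * B)"
      by (metis \<open>h * (1 - P) = (1 - P) * h\<close> mult.assoc)
    moreover have "(1 - P) * (x * h) * B = (1 - P) * x * B * h"
      by (simp only: mult.assoc hB)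
    moreover have "h * x * P = h * (x * P)" "x * h * P = x * P * h"
      by (simp_all only: mult.assoc hP)
    ultimately show "h * x - x * h \<in> T"
      by (simp add: T_def left_diff_distrib[of "h * x"] right_diff_distrib[of "1 - P" "h * x"]
          left_diff_distrib[of "(1 - P) * (h * x)"] x)
  next
    fix X
    assume X: "X * u = X"
    \<comment> \<open>\<open>C\<close> must agree with \<open>X\<close> on im P, and on im B modulo
      im P. Taking the values on im B in ker (e ^ d) makes the extension possible;
      \<open>P * Q\<close> in place of \<open>P\<close> makes \<open>z\<close> vanish on im
      e.\<close>
    define z where "z = X * (P * Q) + (1 - P) * X * B"
    have "\<exists>C. C * e = e * C \<and> C * Q = z"
    proof (rule extend_to_centralizer[OF top Q_def Qe gQ u refl])
      show "\<exists>y. x = e * y" if "e ^ (d - 1) * x = 0" "u * x = x" for x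
      proof -
        have "x = (e * a + b * e ^ (d - 1)) * x"
          unfolding jordan by (simp only: that)
        also have "\<dots> = e * (a * x)"
          using that(1) by (simp add: distrib_right mult.assoc)
        finally show ?thesis by blast
      qed
      show "z * Q = z"
        by (simp add: z_def distrib_right mult.assoc QQ BQ)
      show "z * u = z"
      proof -
        have "x * X * y * u = x * X * y" for x y
          by (metis X u(1) mult.assoc)
        from this[of 1 "P * Q"] this[of "1 - P" B] show ?thesis
          by (simp add: z_def distrib_right)
      qed
      show "e ^ d * z * x = 0" if "e ^ d * x = 0" for x
      proof -
        have "e ^ d * (Q * x) = 0"
        proof -
          have "e ^ d * Q = e ^ d - e ^ Suc d * g"
            unfolding Q_def power_Suc2 by (simp add: right_diff_distrib mult.assoc)
          then show ?thesis
            unfolding top using that by (simp flip: mult.assoc)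
        qed
        then have "P * (Q * x) = 0"
          by (rule P_eq_0)
        moreover have "e ^ d * (1 - P) = 0"
          by (simp add: right_diff_distrib eP)
        moreover have "e ^ d * z * x = e ^ d * X * (P * (Q * x)) + (e ^ d * (1 - P)) * X * B * x"
          by (simp only: z_def distrib_right distrib_left mult.assoc)
        ultimately show ?thesis
          by simp
      qed
    qed
    then obtain C where C: "C * e = e * C" "C * Q = z" by blast
    have "C * P = z * P"
      using C(2) QP by (metis mult.assoc)
    also have "\<dots> = X * P"
      by (simp add: z_def distrib_right mult.assoc QP PP BP)
    finally have "(X - C) * P = 0"
      by (simp add: left_diff_distrib)
    have "C * B = z * B"
      using C(2) QB by (metis mult.assoc)
    then have "C * B = (1 - P) * X * B"
      by (simp add: z_def distrib_right mult.assoc QB PB BB)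
    moreover have "(1 - P) * (1 - P) = 1 - P"
      by (simp add: left_diff_distrib right_diff_distrib PP)
    ultimately have "(1 - P) * (C * B) = (1 - P) * X * B"
      by (metis mult.assoc)
    then have "(1 - P) * (X - C) * B = 0"
      by (simp only: right_diff_distrib[of _ X] left_diff_distrib[of "(1 - P) * X"] mult.assoc diff_self)
    with \<open>(X - C) * P = 0\<close> show "\<exists>C. C * e = e * C \<and> X - C \<in> T"
      using C(1) by (auto simp: T_def)
  next
    fix Y
    assume "Y \<in> T" "Y * e = e * Y"
    then have Y: "Y * e = e * Y" "Y * P = 0" "(1 - P) * Y * B = 0"
      by (simp_all add: T_def)
    have comm: "Y * e ^ k = e ^ k * Y" for k
      by (metis Y(1) power_commuting_commutes)
    have "e ^ d * B = 0"
      by (simp add: B_def right_diff_distrib eP flip: mult.assoc)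
    then have "e ^ d * (Y * B) = 0"
      by (metis comm mult.assoc mult_zero_right)
    then have "P * (Y * B) = 0"
      by (rule P_eq_0)
    then have "Y * B = 0"
      using Y(3) by (simp add: left_diff_distrib mult.assoc)
    then have "Y * Q = 0"
      using Y(2) PB_Q by (metis add_0_left distrib_left mult.assoc mult_zero_left)
    then have step: "Y = Y * (e * g)"
      by (simp add: Q_def right_diff_distrib)
    \<comment> \<open>Vanishing on im Q, \<open>Y\<close> factors through \<open>e * g\<close>.
      Commuting with \<open>e\<close> allows this to be repeated until the power of \<open>e\<close>
      is zero.\<close>
    have "Y = Y * (e ^ k * g ^ k)" for k
    proof (induction k)
      case (Suc k)
      have "Y * (e ^ Suc k * g ^ Suc k) = e ^ k * (Y * (e * g)) * g ^ k"
        unfolding power_Suc2[of e] power_Suc[of g] by (metis comm mult.assoc)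
      also have "\<dots> = Y * (e ^ k * g ^ k)"
        unfolding step[symmetric] by (metis comm mult.assoc)
      finally show ?case
        using Suc by simp
    qed simp
    from this[of "Suc d"] show "Y = 0"
      unfolding top by simp
  qed
qed

end

section \<open>Matrices of fixed size as elements of a ring\<close>

text \<open>
  The size of a matrix is not part of its type. Packing one matrix of each size into a family gives a
  type that is a ring; \<open>embed n\<close> places a matrix in the component \<open>n\<close> and is a ring homomorphism up to the
  unit, which it maps to a central idempotent.
\<close>

typedef mat_family = "{F :: nat \<Rightarrow> complex mat. \<forall>n. F n \<in> carrier_mat n n}"
  morphisms component Abs_mat_family
  by (rule exI[of _ "\<lambda>n. 0\<^sub>m n n"]) simp

setup_lifting type_definition_mat_family

instantiation mat_family :: ring_1
begin

lift_definition zero_mat_family :: mat_family is "\<lambda>n. 0\<^sub>m n n" by simp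
lift_definition one_mat_family :: mat_family is "\<lambda>n. 1\<^sub>m n" by simp
lift_definition plus_mat_family :: "mat_family \<Rightarrow> mat_family \<Rightarrow> mat_family" is "\<lambda>F G n. F n + G n" by simp
lift_definition minus_mat_family :: "mat_family \<Rightarrow> mat_family \<Rightarrow> mat_family" is "\<lambda>F G n. F n - G n"
  by (simp add: minus_carrier_mat)
lift_definition uminus_mat_family :: "mat_family \<Rightarrow> mat_family" is "\<lambda>F n. - F n" by simp
lift_definition times_mat_family :: "mat_family \<Rightarrow> mat_family \<Rightarrow> mat_family" is "\<lambda>F G n. F n * G n" by (metis mult_carrier_mat)

lemma component_carrier: "component F n \<in> carrier_mat n n"
  by transfer simp

lemma mat_family_eqI: "(\<And>n. component F n = component G n) \<Longrightarrow> F = G"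
  by (simp add: component_inject[symmetric] fun_eq_iff)

lemmas component_simps =
  zero_mat_family.rep_eq one_mat_family.rep_eq plus_mat_family.rep_eq minus_mat_family.rep_eq
  uminus_mat_family.rep_eq times_mat_family.rep_eq

instance
proof
  fix a b c :: mat_family
  note C = component_carrier
  show "a * b * c = a * (b * c)"
    by (rule mat_family_eqI) (simp only: component_simps assoc_mult_mat[OF C C C])
  show "1 * a = a" "a * 1 = a" "0 + a = a"
    by (rule mat_family_eqI, simp only: component_simps left_mult_one_mat[OF C] right_mult_one_mat[OF C] left_add_zero_mat[OF C])+
  show "a + b + c = a + (b + c)"
    by (rule mat_family_eqI) (simp only: component_simps assoc_add_mat[OF C C C])
  show "a + b = b + a"
    by (rule mat_family_eqI) (simp only: component_simps comm_add_mat[OF C C])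
  show "- a + a = 0"
    by (rule mat_family_eqI) (simp only: component_simps uminus_l_inv_mat[OF C])
  show "a - b = a + - b"
    by (rule mat_family_eqI) (simp only: component_simps minus_add_uminus_mat[OF C C])
  show "(a + b) * c = a * c + b * c"
    by (rule mat_family_eqI) (simp only: component_simps add_mult_distrib_mat[OF C C C])
  show "a * (b + c) = a * b + a * c"
    by (rule mat_family_eqI) (simp only: component_simps mult_add_distrib_mat[OF C C C])
  \<comment> \<open>Component 0 is the zero ring of empty matrices, so 0 and 1 are told apart in
    component 1.\<close>
  have "component 0 1 $$ (0, 0) \<noteq> component 1 1 $$ (0, 0)"
    by (simp add: component_simps)
  then show "(0 :: mat_family) \<noteq> 1"
    by metis
qed

end

declare component_carrier [simp] component_simps [simp]

lemma component_dim [simp]: "dim_row (component F n) = n" "dim_col (component F n) = n"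
  using component_carrier by blast+

lemma mat_family_invertible: "\<exists>y::mat_family. of_nat (Suc k) * y = 1"
proof -
  define y where "y = Abs_mat_family (\<lambda>n. (1 / of_nat (Suc k)) \<cdot>\<^sub>m 1\<^sub>m n)"
  have y: "component y n = (1 / of_nat (Suc k)) \<cdot>\<^sub>m 1\<^sub>m n" for n
    unfolding y_def by (subst Abs_mat_family_inverse) simp_all
  have of_nat: "component (of_nat m) n = of_nat m \<cdot>\<^sub>m 1\<^sub>m n" for m n
    by (induction m) (auto simp: algebra_simps)
  then have "component (of_nat (Suc k) * y) n = component 1 n" for n
    unfolding component_simps y of_nat
    by (subst mult_smult_assoc_mat[of _ n n _ n])
      (auto simp: field_simps simp del: of_nat_Suc)
  then have "of_nat (Suc k) * y = 1"
    by (simp add: component_inject[symmetric] fun_eq_iff del: of_nat_Suc component_simps)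
  then show ?thesis ..
qed

lift_definition embed :: "nat \<Rightarrow> complex mat \<Rightarrow> mat_family" is
  "\<lambda>n A m. if m = n \<and> A \<in> carrier_mat n n then A else 0\<^sub>m m m"
  by auto

lemma component_embed: "A \<in> carrier_mat n n \<Longrightarrow> component (embed n A) n = A"
  by (simp add: embed.rep_eq)

lemma mat_family_eq_iff: "F = G \<longleftrightarrow> (\<forall>n. component F n = component G n)"
  by (simp add: component_inject[symmetric] fun_eq_iff)

lemma embed_ring:
  assumes "A \<in> carrier_mat n n" "B \<in> carrier_mat n n"
  shows "embed n (A + B) = embed n A + embed n B"
    and "embed n (A - B) = embed n A - embed n B"
    and "embed n (A * B) = embed n A * embed n B"
    and "embed n (- A) = - embed n A"
  using assms by (auto simp: mat_family_eq_iff embed.rep_eq)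

lemma embed_0: "embed n (0\<^sub>m n n) = 0"
  by (auto simp: mat_family_eq_iff embed.rep_eq)

lemma embed_1_commute: "embed n (1\<^sub>m n) * F = F * embed n (1\<^sub>m n)"
  by (auto simp: mat_family_eq_iff embed.rep_eq)

text \<open>The idempotent factor matters at \<open>k = 0\<close>, where the power on the left is
  the unit of all components at once.\<close>

lemma embed_power:
  assumes "A \<in> carrier_mat n n"
  shows "embed n (1\<^sub>m n) * embed n A ^ k = embed n (A ^\<^sub>m k)"
proof (induction k)
  case (Suc k)
  then show ?case
    unfolding power_Suc2 pow_mat.simps
    using assms by (simp add: embed_ring flip: mult.assoc)
qed (use assms in auto)

lemma embed_Suc_power:
  assumes "A \<in> carrier_mat n n"
  shows "embed n A ^ Suc k = embed n (A ^\<^sub>m Suc k)"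
proof -
  have "embed n (1\<^sub>m n) * embed n A = embed n A"
    using assms embed_ring(3)[of "1\<^sub>m n" n A] by simp
  then have "embed n (1\<^sub>m n) * embed n A ^ Suc k = embed n A ^ Suc k"
    by (simp flip: mult.assoc)
  then show ?thesis
    using embed_power[OF assms] by metis
qed

text \<open>Turns closure under central multiples in the ring into closure under complex
  scalars.\<close>

lemma embed_scalar_commute: "embed n (c \<cdot>\<^sub>m 1\<^sub>m n) * F = F * embed n (c \<cdot>\<^sub>m 1\<^sub>m n)"
proof -
  have "(c \<cdot>\<^sub>m 1\<^sub>m n) * component F n = component F n * (c \<cdot>\<^sub>m 1\<^sub>m n)"
    by (simp add: mult_smult_assoc_mat[of _ n n _ n] mult_smult_distrib[of _ n n _ n])
  then show ?thesis
    by (auto simp: mat_family_eq_iff embed.rep_eq)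
qed

lemma embed_component: "embed n (component F n) = embed n (1\<^sub>m n) * F"
  by (auto simp: mat_family_eq_iff embed.rep_eq)

section \<open>Transfer of the complement to matrices of size n\<close>

lemma centralizer_complement_mat:
  fixes h :: "complex mat"
  assumes carrier: "h \<in> carrier_mat n n" "e \<in> carrier_mat n n" "f \<in> carrier_mat n n"
      "a \<in> carrier_mat n n" "b \<in> carrier_mat n n"
    and he: "h * e - e * h = e + e" and hf: "h * f - f * h = - (f + f)" and ef: "e * f - f * e = h"
    and top: "e ^\<^sub>m Suc d = 0\<^sub>m n n"
    and jordan: "e * a + b * e ^\<^sub>m (d - 1) = 1\<^sub>m n"
  obtains T where "T \<subseteq> carrier_mat n n" "0\<^sub>m n n \<in> T" "\<And>X Y. X \<in> T \<Longrightarrow> Y \<in> T \<Longrightarrow> X + Y \<in> T"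
    and "\<And>X Y. X \<in> T \<Longrightarrow> Y \<in> T \<Longrightarrow> X * Y \<in> T" "\<And>c X. X \<in> T \<Longrightarrow> c \<cdot>\<^sub>m X \<in> T"
    and "\<And>X. X \<in> T \<Longrightarrow> h * X - X * h \<in> T"
    and "\<And>X. X \<in> carrier_mat n n \<Longrightarrow> \<exists>C \<in> carrier_mat n n. C * e = e * C \<and> X - C \<in> T"
    and "\<And>Y. Y \<in> T \<Longrightarrow> Y * e = e * Y \<Longrightarrow> Y = 0\<^sub>m n n"
proof -
  interpret sl2 "embed n e" "embed n f" "embed n h"
  proof
    show "embed n h * embed n e - embed n e * embed n h = 2 * embed n e"
      using carrier by (simp add: mult_2 he flip: embed_ring)
    show "embed n h * embed n f - embed n f * embed n h = - (2 * embed n f)"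
      using carrier by (simp add: mult_2 hf flip: embed_ring)
    show "embed n e * embed n f - embed n f * embed n e = embed n h"
      using carrier by (simp add: ef flip: embed_ring)
  qed (rule mat_family_invertible)
  let ?u = "embed n (1\<^sub>m n)"
  have pow: "e ^\<^sub>m k \<in> carrier_mat n n" for k
    using carrier by simp
  have top': "embed n e ^ Suc d = 0"
    unfolding embed_Suc_power[OF carrier(2)] top embed_0 ..
  have "embed n b * ?u * embed n e ^ (d - 1) = embed n b * embed n (e ^\<^sub>m (d - 1))"
    using carrier by (simp add: embed_power mult.assoc)
  then have jordan': "embed n e * embed n a + embed n b * embed n e ^ (d - 1) = ?u"
    using carrier pow jordan by (simp flip: embed_ring)
  have idem: "?u * ?u = ?u"
    by (simp flip: embed_ring)
  show thesis
  proof (rule centralizer_complement[OF top' jordan' embed_1_commute idem])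
    fix T assume T: "0 \<in> T" "\<And>x y. x \<in> T \<Longrightarrow> y \<in> T \<Longrightarrow> x + y \<in> T"
    "\<And>x y. x \<in> T \<Longrightarrow> y \<in> T \<Longrightarrow> x * y \<in> T"
    "\<And>c x. (\<And>y. c * y = y * c) \<Longrightarrow> x \<in> T \<Longrightarrow> c * x \<in> T"
    "\<And>x. x \<in> T \<Longrightarrow> embed n h * x - x * embed n h \<in> T"
    "\<And>X. X * ?u = X \<Longrightarrow> \<exists>C. C * embed n e = embed n e * C \<and> X - C \<in> T"
    "\<And>Y. Y \<in> T \<Longrightarrow> Y * embed n e = embed n e * Y \<Longrightarrow> Y = 0"
    define T' where "T' = {X \<in> carrier_mat n n. embed n X \<in> T}"
    show thesis
    proof (rule that[of T'])
      show "T' \<subseteq> carrier_mat n n" "0\<^sub>m n n \<in> T'"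
        using T(1) by (auto simp: T'_def embed_0)
      show "X + Y \<in> T'" "X * Y \<in> T'" if "X \<in> T'" "Y \<in> T'" for X Y
        using that T(2,3) by (auto simp: T'_def embed_ring)
      show "c \<cdot>\<^sub>m X \<in> T'" if "X \<in> T'" for c X
      proof -
        have X: "X \<in> carrier_mat n n" "embed n X \<in> T"
          using that by (auto simp: T'_def)
        have "c \<cdot>\<^sub>m X = (c \<cdot>\<^sub>m 1\<^sub>m n) * X"
          using X(1) by (simp add: mult_smult_assoc_mat[of _ n n _ n])
        then have "embed n (c \<cdot>\<^sub>m X) = embed n (c \<cdot>\<^sub>m 1\<^sub>m n) * embed n X"
          using X(1) embed_ring(3)[of "c \<cdot>\<^sub>m 1\<^sub>m n" n X] by simp
        then show ?thesis
          using X T(4)[OF embed_scalar_commute] by (simp add: T'_def)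
      qed
      show "h * X - X * h \<in> T'" if "X \<in> T'" for X
      proof -
        have X: "X \<in> carrier_mat n n" "embed n X \<in> T"
          using that by (auto simp: T'_def)
        then have "h * X \<in> carrier_mat n n" "X * h \<in> carrier_mat n n"
          using carrier by auto
        then show ?thesis
          using X carrier T(5)[of "embed n X"] by (simp add: T'_def embed_ring minus_carrier_mat)
      qed
      show "\<exists>C \<in> carrier_mat n n. C * e = e * C \<and> X - C \<in> T'" if X: "X \<in> carrier_mat n n" for X
      proof -
        have uX: "?u * embed n X = embed n X"
          using X embed_ring(3)[of "1\<^sub>m n" n X] by simp
        then obtain C where C: "C * embed n e = embed n e * C" "embed n X - C \<in> T"
          using T(6)[of "embed n X"] by (auto simp: embed_1_commute)
        \<comment> \<open>\<open>C\<close> may be nonzero in other components; the central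
          idempotent cuts them off without leaving \<open>T\<close>.\<close>
        have "?u * (embed n X - C) = embed n (X - component C n)"
          using X by (simp add: embed_ring embed_component uX right_diff_distrib)
        then have "X - component C n \<in> T'"
          using X T(4)[OF embed_1_commute C(2), of n] by (simp add: T'_def minus_carrier_mat)
        moreover have "component C n * e = e * component C n"
          using arg_cong[OF C(1), of "\<lambda>F. component F n"] carrier by (simp add: component_embed)
        ultimately show ?thesis
          by (intro bexI[of _ "component C n"]) simp_all
      qed
      show "Y = 0\<^sub>m n n" if "Y \<in> T'" "Y * e = e * Y" for Y
      proof -
        have Y: "Y \<in> carrier_mat n n" "embed n Y \<in> T"
          using that by (auto simp: T'_def)
        have "embed n Y * embed n e = embed n e * embed n Y"
          using Y carrier that(2) by (simp flip: embed_ring)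
        then have "embed n Y = 0"
          using T(7) Y(2) by blast
        then show ?thesis
          using component_embed[OF Y(1)] by simp
      qed
    qed
  qed
qed

section \<open>Nilpotent Jordan matrices\<close>

text \<open>An equational form of ker (J ^ k) lying in im J. With the transposed shift
  \<open>?a\<close>, the product J a is the identity except for a zero in the last diagonal entry;
  \<open>?b\<close> supplies it by moving row m - 1 - k of J ^ k, whose only 1 is in the last
  column, to the bottom.\<close>

lemma jordan_block_zero_unit:
  assumes "k < m"
  shows "\<exists>a b. a \<in> carrier_mat m m \<and> b \<in> carrier_mat m m \<and>
    jordan_block m (0::'a::field) * a + b * jordan_block m 0 ^\<^sub>m k = 1\<^sub>m m"
proof (intro exI conjI)
  let ?a = "mat m m (\<lambda>(i, j). if i = Suc j then 1 else 0) :: 'a mat"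
  let ?b = "mat m m (\<lambda>(i, j). if Suc i = m \<and> j + k = i then 1 else 0) :: 'a mat"
  show "?a \<in> carrier_mat m m" "?b \<in> carrier_mat m m"
    by simp_all
  have "(jordan_block m 0 * ?a) $$ (i, j) = (if i = j \<and> Suc i < m then 1 else 0)"
    if "i < m" "j < m" for i j
  proof -
    have "(jordan_block m 0 * ?a) $$ (i, j) = (\<Sum>l = 0..<m. jordan_block m 0 $$ (i, l) * ?a $$ (l, j))"
      using that by (simp add: scalar_prod_def)
    also have "\<dots> = (\<Sum>l = 0..<m. if l = Suc i then (if i = j then 1 else 0) else 0)"
      using that by (intro sum.cong) auto
    finally show ?thesis by simp
  qed
  moreover have "(?b * jordan_block m 0 ^\<^sub>m k) $$ (i, j) = (if i = j \<and> Suc i = m then 1 else 0)"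
    if "i < m" "j < m" for i j
  proof -
    have "(?b * jordan_block m 0 ^\<^sub>m k) $$ (i, j) = (\<Sum>l = 0..<m. ?b $$ (i, l) * (jordan_block m 0 ^\<^sub>m k) $$ (l, j))"
      using that by (simp add: scalar_prod_def)
    also have "\<dots> = (\<Sum>l = 0..<m. if l = m - 1 - k then (if i = j \<and> Suc i = m then 1 else 0) else 0)"
      unfolding jordan_block_zero_pow using that assms by (intro sum.cong) auto
    finally show ?thesis using assms by simp
  qed
  ultimately show "jordan_block m (0::'a) * ?a + ?b * jordan_block m 0 ^\<^sub>m k = 1\<^sub>m m"
    by (intro eq_matI) (auto simp: less_Suc_eq Suc_lessI)
qed

lemma jordan_matrix_zero_Cons_pow:
  "jordan_matrix ((m, 0::'a::field) # n_as) ^\<^sub>m k = four_block_mat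
    (jordan_block m 0 ^\<^sub>m k) (0\<^sub>m m (sum_list (map fst n_as)))
    (0\<^sub>m (sum_list (map fst n_as)) m) (jordan_matrix n_as ^\<^sub>m k)"
proof -
  have "dim_row (jordan_matrix n_as ^\<^sub>m k) = sum_list (map fst n_as)"
    "dim_col (jordan_matrix n_as ^\<^sub>m k) = sum_list (map fst n_as)"
    by (simp_all add: pow_mat_dim_square[OF jordan_matrix_carrier])
  then show ?thesis
    unfolding jordan_matrix_pow by (simp add: Let_def)
qed

lemma jordan_matrix_zero_unit:
  assumes "\<And>m a. (m, a) \<in> set n_as \<Longrightarrow> a = 0 \<and> k < m"
  defines "N \<equiv> sum_list (map fst n_as)"
  shows "\<exists>a b. a \<in> carrier_mat N N \<and> b \<in> carrier_mat N N \<and>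
    jordan_matrix n_as * a + b * jordan_matrix n_as ^\<^sub>m k = (1\<^sub>m N :: 'a::field mat)"
  using assms(1) unfolding N_def
proof (induction n_as)
  case Nil
  show ?case
    by (intro exI[of _ "0\<^sub>m 0 0"] conjI eq_matI) auto
next
  case (Cons p n_as)
  obtain m where p: "p = (m, 0)" "k < m"
    using Cons.prems by (cases p) auto
  let ?N = "sum_list (map fst n_as)"
  let ?Z = "0\<^sub>m m ?N :: 'a mat" and ?W = "0\<^sub>m ?N m :: 'a mat"
  obtain a b where ab: "a \<in> carrier_mat m m" "b \<in> carrier_mat m m"
    "jordan_block m (0::'a) * a + b * jordan_block m 0 ^\<^sub>m k = 1\<^sub>m m"
    using jordan_block_zero_unit p(2) by blast
  obtain c d where cd: "c \<in> carrier_mat ?N ?N" "d \<in> carrier_mat ?N ?N"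
    "jordan_matrix n_as * c + d * jordan_matrix n_as ^\<^sub>m k = 1\<^sub>m ?N"
    using Cons by (metis list.set_intros(2))
  note J = jordan_block_carrier[of m "0::'a"] jordan_matrix_carrier[of n_as]
  note Jk = pow_carrier_mat[OF J(1), of k] pow_carrier_mat[OF J(2), of k]
  have 1: "jordan_matrix (p # n_as) * four_block_mat a ?Z ?W c =
    four_block_mat (jordan_block m 0 * a) ?Z ?W (jordan_matrix n_as * c)"
    unfolding p jordan_matrix_Cons
    by (subst mult_four_block_mat[OF J(1) _ _ J(2) ab(1) _ _ cd(1)])
      (use J ab cd mult_carrier_mat[OF J(1) ab(1)] mult_carrier_mat[OF J(2) cd(1)] in simp_all)
  have 2: "four_block_mat b ?Z ?W d * jordan_matrix (p # n_as) ^\<^sub>m k =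
    four_block_mat (b * jordan_block m 0 ^\<^sub>m k) ?Z ?W (d * jordan_matrix n_as ^\<^sub>m k)"
    unfolding p jordan_matrix_zero_Cons_pow
    by (subst mult_four_block_mat[OF ab(2) _ _ cd(2) Jk(1) _ _ Jk(2)])
      (use Jk ab cd mult_carrier_mat[OF ab(2) Jk(1)] mult_carrier_mat[OF cd(2) Jk(2)] in simp_all)
  have "jordan_matrix (p # n_as) * four_block_mat a ?Z ?W c
    + four_block_mat b ?Z ?W d * jordan_matrix (p # n_as) ^\<^sub>m k = 1\<^sub>m (m + ?N)"
    unfolding 1 2
    by (subst add_four_block_mat[OF mult_carrier_mat[OF J(1) ab(1)] _ _ mult_carrier_mat[OF J(2) cd(1)]
          mult_carrier_mat[OF ab(2) Jk(1)] _ _ mult_carrier_mat[OF cd(2) Jk(2)]])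
      (simp_all add: ab(3) cd(3))
  moreover have "four_block_mat a ?Z ?W c \<in> carrier_mat (m + ?N) (m + ?N)"
    "four_block_mat b ?Z ?W d \<in> carrier_mat (m + ?N) (m + ?N)"
    using ab cd by simp_all
  moreover have "sum_list (map fst (p # n_as)) = m + ?N"
    by (simp add: p)
  ultimately show ?case
    by (metis (no_types))
qed

lemma jordan_matrix_zero_pow_eq_0:
  assumes "\<And>m a. (m, a) \<in> set n_as \<Longrightarrow> a = 0 \<and> m \<le> k"
  shows "jordan_matrix n_as ^\<^sub>m k =
    (0\<^sub>m (sum_list (map fst n_as)) (sum_list (map fst n_as)) :: 'a::field mat)"
  using assms
proof (induction n_as)
  case Nil
  show ?case
    by (intro eq_matI) (auto simp: pow_mat_dim_square[OF jordan_matrix_carrier])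
next
  case (Cons p n_as)
  obtain m where p: "p = (m, 0)" "m \<le> k"
    using Cons.prems by (cases p) auto
  have "jordan_block m (0::'a) ^\<^sub>m k = 0\<^sub>m m m"
    unfolding jordan_block_zero_pow using p(2) by (intro eq_matI) auto
  moreover have "jordan_matrix n_as ^\<^sub>m k = (0\<^sub>m (sum_list (map fst n_as)) (sum_list (map fst n_as)) :: 'a mat)"
    using Cons by (metis list.set_intros(2))
  ultimately show ?case
    unfolding p jordan_matrix_zero_Cons_pow by simp
qed

lemma nilpotent_jordan_nf_zero:
  assumes e: "e \<in> carrier_mat n n" and "nilpotent_mat e" "jordan_nf e n_as" "(m, a) \<in> set n_as"
  shows "a = 0"
proof -
  obtain k where k: "e ^\<^sub>m k = 0\<^sub>m n n"
    using assms by (auto simp: nilpotent_mat_def)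
  have "m \<noteq> 0"
    using assms(3,4) by (force simp: jordan_nf_def)
  then have "poly (char_poly e) a = 0"
    using assms(4) unfolding jordan_nf_char_poly[OF assms(3)]
    by (force simp: poly_prod_list)
  then obtain v where v: "eigenvector e v a"
    using eigenvalue_root_char_poly[OF e] by (auto simp: eigenvalue_def)
  then have v': "v \<in> carrier_vec n" "v \<noteq> 0\<^sub>v n"
    using e by (auto simp: eigenvector_def)
  have "0\<^sub>m n n *\<^sub>v v = 0\<^sub>v n"
    using v' by (intro eq_vecI) auto
  then have zero: "a ^ k \<cdot>\<^sub>v v = 0\<^sub>v n"
    using eigenvector_pow[OF e v, of k] k by simp
  obtain i where i: "i < n" "v $ i \<noteq> 0"
    using v' by (metis carrier_vecD eq_vecI index_zero_vec)
  then have "a ^ k * v $ i = 0"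
    using arg_cong[OF zero, of "\<lambda>w. w $ i"] v' by simp
  then have "a ^ k = 0"
    using i by simp
  then show ?thesis by simp
qed

lemma jordan_nf_unit:
  assumes e: "e \<in> carrier_mat n n" and "nilpotent_mat e" and nf: "jordan_nf e n_as"
    and close: "\<forall>p\<in>fst ` set n_as. \<forall>q\<in>fst ` set n_as. p \<le> q + 1"
  obtains d a b where "e ^\<^sub>m Suc d = 0\<^sub>m n n" "a \<in> carrier_mat n n" "b \<in> carrier_mat n n"
    "e * a + b * e ^\<^sub>m (d - 1) = 1\<^sub>m n"
proof -
  \<comment> \<open>Inserting 1 keeps the maximum defined for \<open>n = 0\<close>, where there are
    no blocks. If all blocks have size 1, then d = 0 and \<open>d - 1\<close> truncates to 0, still
    below every block size.\<close>
  define d where "d = Max (insert 1 (fst ` set n_as)) - 1"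
  have zero: "x = 0" if "(m, x) \<in> set n_as" for m x
    using nilpotent_jordan_nf_zero[OF e assms(2) nf that] .
  have le: "m \<le> Suc d" if "(m, x) \<in> set n_as" for m x
  proof -
    have "m \<le> Max (insert 1 (fst ` set n_as))"
      using that by (intro Max_ge) force+
    then show ?thesis by (simp add: d_def)
  qed
  have less: "d - 1 < m" if m: "(m, x) \<in> set n_as" for m x
  proof -
    have "Max (insert 1 (fst ` set n_as)) \<in> insert 1 (fst ` set n_as)"
      by (intro Max_in) auto
    moreover have mem: "m \<in> fst ` set n_as"
      using m by force
    then have "m \<noteq> 0"
      using nf by (metis jordan_nf_def)
    ultimately have "Max (insert 1 (fst ` set n_as)) \<le> m + 1"
      using close mem by (metis insertE le_add2)
    with \<open>m \<noteq> 0\<close>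
    show ?thesis unfolding d_def by linarith
  qed
  let ?J = "jordan_matrix n_as"
  obtain P Q where wit: "similar_mat_wit e ?J P Q"
    using nf by (auto simp: jordan_nf_def similar_mat_def)
  have C: "?J \<in> carrier_mat n n" "P \<in> carrier_mat n n" "Q \<in> carrier_mat n n"
    and PQ: "P * Q = 1\<^sub>m n" "Q * P = 1\<^sub>m n" "e = P * ?J * Q"
    using similar_mat_witD2[OF e wit] by auto
  have n: "sum_list (map fst n_as) = n"
    using carrier_matD(1)[OF C(1)] by simp
  have "x = 0 \<and> d - 1 < m" if "(m, x) \<in> set n_as" for m x
    using zero[OF that] less[OF that] by simp
  then obtain a b where ab: "a \<in> carrier_mat n n" "b \<in> carrier_mat n n"
    "?J * a + b * ?J ^\<^sub>m (d - 1) = 1\<^sub>m n"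
    using jordan_matrix_zero_unit[of n_as "d - 1"] unfolding n by blast
  have pow: "e ^\<^sub>m k = P * ?J ^\<^sub>m k * Q" for k
    by (rule similar_mat_wit_pow_id[OF wit])
  have Jk: "?J ^\<^sub>m k \<in> carrier_mat n n" for k
    using C(1) by simp
  have cancel: "(X * Q) * (P * Y * Q) = X * Y * Q" "(P * Y * Q) * (P * X) = P * Y * X"
    if "X \<in> carrier_mat n n" "Y \<in> carrier_mat n n" for X Y
  proof -
    have "(X * Q) * (P * Y * Q) = X * (Q * P) * (Y * Q)" "(P * Y * Q) * (P * X) = P * Y * (Q * P) * X"
      using that C by (simp_all add: assoc_mult_mat[of _ n n _ n _ n])
    then show "(X * Q) * (P * Y * Q) = X * Y * Q" "(P * Y * Q) * (P * X) = P * Y * X"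
      using that C by (simp_all add: PQ assoc_mult_mat[of _ n n _ n _ n])
  qed
  show thesis
  proof (rule that)
    have "x = 0 \<and> m \<le> Suc d" if "(m, x) \<in> set n_as" for m x
      using zero[OF that] le[OF that] by simp
    then have "?J ^\<^sub>m Suc d = 0\<^sub>m n n"
      using jordan_matrix_zero_pow_eq_0[of n_as "Suc d"] unfolding n by blast
    then show "e ^\<^sub>m Suc d = 0\<^sub>m n n"
      unfolding pow using C by simp
    show "P * a * Q \<in> carrier_mat n n" "P * b * Q \<in> carrier_mat n n"
      using C ab by auto
    have "e * (P * a * Q) = P * (?J * a) * Q"
      unfolding PQ(3) using C ab cancel(2)[of "a * Q" ?J] by (simp add: assoc_mult_mat[of _ n n _ n _ n])
    moreover have "(P * b * Q) * e ^\<^sub>m (d - 1) = P * (b * ?J ^\<^sub>m (d - 1)) * Q"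
      unfolding pow using C ab Jk cancel(1)[of "P * b" "?J ^\<^sub>m (d - 1)"]
      by (simp add: assoc_mult_mat[of _ n n _ n _ n])
    moreover have "P * X * Q + P * Y * Q = P * (X + Y) * Q"
      if "X \<in> carrier_mat n n" "Y \<in> carrier_mat n n" for X Y
      using C that by (simp add: mult_add_distrib_mat[of _ n n _ n] add_mult_distrib_mat[of _ n n _ _ n])
    then have "P * (?J * a) * Q + P * (b * ?J ^\<^sub>m (d - 1)) * Q = P * (?J * a + b * ?J ^\<^sub>m (d - 1)) * Q"
      using mult_carrier_mat[OF C(1) ab(1)] mult_carrier_mat[OF ab(2) Jk] by blast
    ultimately have "e * (P * a * Q) + (P * b * Q) * e ^\<^sub>m (d - 1) = P * 1\<^sub>m n * Q"
      by (simp only: ab(3))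
    then show "e * (P * a * Q) + (P * b * Q) * e ^\<^sub>m (d - 1) = 1\<^sub>m n"
      using C(2) PQ(1) by simp
  qed
qed

section \<open>Complements in the special linear algebra\<close>

lemma mtrace_add:
  assumes "A \<in> carrier_mat n n" "B \<in> carrier_mat n n"
  shows "mtrace (A + B) = mtrace A + mtrace B"
  using assms by (auto simp: mtrace_def sum.distrib)

lemma mtrace_minus:
  assumes "A \<in> carrier_mat n n" "B \<in> carrier_mat n n"
  shows "mtrace (A - B) = mtrace A - mtrace B"
  using assms by (auto simp: mtrace_def sum_subtractf)

lemma mtrace_smult: "A \<in> carrier_mat n n \<Longrightarrow> mtrace (c \<cdot>\<^sub>m A) = c * mtrace A"
  by (auto simp: mtrace_def sum_distrib_left)

lemma mtrace_one: "mtrace (1\<^sub>m n) = of_nat n"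
  by (simp add: mtrace_def)

lemma mtrace_mult_comm:
  assumes "A \<in> carrier_mat n n" "B \<in> carrier_mat n n"
  shows "mtrace (A * B) = mtrace (B * A)"
proof -
  have expand: "mtrace (X * Y) = (\<Sum>i<n. \<Sum>j<n. X $$ (i, j) * Y $$ (j, i))"
    if "X \<in> carrier_mat n n" "Y \<in> carrier_mat n n" for X Y
    using that by (auto simp: mtrace_def scalar_prod_def atLeast0LessThan intro!: sum.cong)
  show ?thesis
    unfolding expand[OF assms] expand[OF assms(2,1)]
    by (subst sum.swap) (simp add: mult.commute)
qed

lemma lie_bracket_in_sl:
  assumes "A \<in> carrier_mat n n" "B \<in> carrier_mat n n"
  shows "lie_bracket A B \<in> sl n"
proof -
  have "A * B \<in> carrier_mat n n" "B * A \<in> carrier_mat n n"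
    using assms by auto
  then show ?thesis
    using mtrace_minus mtrace_mult_comm[OF assms] by (auto simp: lie_bracket_def sl_def minus_carrier_mat)
qed

lemma mult_shift:
  fixes A B :: "complex mat"
  assumes "A \<in> carrier_mat n n" "B \<in> carrier_mat n n"
  shows "(A + s \<cdot>\<^sub>m 1\<^sub>m n) * B = A * B + s \<cdot>\<^sub>m B" "B * (A + s \<cdot>\<^sub>m 1\<^sub>m n) = B * A + s \<cdot>\<^sub>m B"
  using assms
  by (simp_all add: add_mult_distrib_mat[of _ n n _ _ n] mult_add_distrib_mat[of _ n n _ n]
      mult_smult_assoc_mat[of _ n n _ n] mult_smult_distrib[of _ n n _ n])

lemma lie_bracket_shift:
  assumes "A \<in> carrier_mat n n" "B \<in> carrier_mat n n"
  shows "lie_bracket (A + s \<cdot>\<^sub>m 1\<^sub>m n) B = lie_bracket A B" "lie_bracket B (A + s \<cdot>\<^sub>m 1\<^sub>m n) = lie_bracket B A"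
proof -
  have "A * B \<in> carrier_mat n n" "B * A \<in> carrier_mat n n"
    using assms by auto
  then show "lie_bracket (A + s \<cdot>\<^sub>m 1\<^sub>m n) B = lie_bracket A B"
    "lie_bracket B (A + s \<cdot>\<^sub>m 1\<^sub>m n) = lie_bracket B A"
    unfolding lie_bracket_def mult_shift[OF assms] using assms by (intro eq_matI; auto)+
qed

text \<open>
  Adding scalar matrices does not change brackets. Hence a complement \<open>T\<close> of the centralizer in the
  full matrix algebra yields the complement \<open>(T + scalars) \<inter> sl n\<close> of the centralizer in \<open>sl n\<close>.
\<close>

lemma sl_complement:
  assumes h: "h \<in> carrier_mat n n" and e: "e \<in> carrier_mat n n"
    and T: "T \<subseteq> carrier_mat n n" "0\<^sub>m n n \<in> T"
    and T_add: "\<And>X Y. X \<in> T \<Longrightarrow> Y \<in> T \<Longrightarrow> X + Y \<in> T"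
    and T_mult: "\<And>X Y. X \<in> T \<Longrightarrow> Y \<in> T \<Longrightarrow> X * Y \<in> T"
    and T_smult: "\<And>c X. X \<in> T \<Longrightarrow> c \<cdot>\<^sub>m X \<in> T"
    and T_h: "\<And>X. X \<in> T \<Longrightarrow> h * X - X * h \<in> T"
    and T_ex: "\<And>X. X \<in> carrier_mat n n \<Longrightarrow> \<exists>C \<in> carrier_mat n n. C * e = e * C \<and> X - C \<in> T"
    and T_unique: "\<And>Y. Y \<in> T \<Longrightarrow> Y * e = e * Y \<Longrightarrow> Y = 0\<^sub>m n n"
  shows "\<exists>S. lie_subalgebra n S \<and> (\<forall>X\<in>S. lie_bracket h X \<in> S) \<and> direct_sum_decomp n (centralizer n e) S"
proof -
  define S where "S = {X \<in> sl n. \<exists>t. X + t \<cdot>\<^sub>m 1\<^sub>m n \<in> T}"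
  have T_diff: "X - Y \<in> T" if "X \<in> T" "Y \<in> T" for X Y
  proof -
    have "X - Y = X + (- 1) \<cdot>\<^sub>m Y"
      using that T(1) by (intro eq_matI) auto
    then show ?thesis
      using that T_add T_smult by metis
  qed
  have sl: "X \<in> carrier_mat n n" "mtrace X = 0" if "X \<in> sl n" for X
    using that by (auto simp: sl_def)
  have add0: "X + 0 \<cdot>\<^sub>m 1\<^sub>m n = X" if "X \<in> carrier_mat n n" for X :: "complex mat"
    using that by (intro eq_matI) auto
  have S_I: "X \<in> S" if "X \<in> sl n" "X \<in> T" for X
    unfolding S_def using that add0[OF sl(1)[OF that(1)]] by (intro CollectI conjI exI[of _ 0]) simp_all
  have S_E: "\<exists>t. X + t \<cdot>\<^sub>m 1\<^sub>m n \<in> T" "X \<in> sl n" "X \<in> carrier_mat n n" if "X \<in> S" for X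
    using that by (auto simp: S_def intro: sl(1))
  have S_add: "X + Y \<in> S" if X: "X \<in> S" and Y: "Y \<in> S" for X Y
  proof -
    obtain s t where st: "X + s \<cdot>\<^sub>m 1\<^sub>m n \<in> T" "Y + t \<cdot>\<^sub>m 1\<^sub>m n \<in> T"
      using S_E(1)[OF X] S_E(1)[OF Y] by blast
    have "X + Y + (s + t) \<cdot>\<^sub>m 1\<^sub>m n = (X + s \<cdot>\<^sub>m 1\<^sub>m n) + (Y + t \<cdot>\<^sub>m 1\<^sub>m n)"
      using S_E(3)[OF X] S_E(3)[OF Y] by (intro eq_matI) auto
    then have "X + Y + (s + t) \<cdot>\<^sub>m 1\<^sub>m n \<in> T"
      using T_add st by metis
    moreover have "X + Y \<in> sl n"
      using sl[OF S_E(2)[OF X]] sl[OF S_E(2)[OF Y]] by (auto simp: sl_def mtrace_add)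
    ultimately show ?thesis
      unfolding S_def by blast
  qed
  have S_smult: "c \<cdot>\<^sub>m X \<in> S" if X: "X \<in> S" for c X
  proof -
    obtain s where s: "X + s \<cdot>\<^sub>m 1\<^sub>m n \<in> T"
      using S_E(1)[OF X] by blast
    have "c \<cdot>\<^sub>m X + (c * s) \<cdot>\<^sub>m 1\<^sub>m n = c \<cdot>\<^sub>m (X + s \<cdot>\<^sub>m 1\<^sub>m n)"
      using S_E(3)[OF X] by (intro eq_matI) (auto simp: algebra_simps)
    then have "c \<cdot>\<^sub>m X + (c * s) \<cdot>\<^sub>m 1\<^sub>m n \<in> T"
      using T_smult s by metis
    moreover have "c \<cdot>\<^sub>m X \<in> sl n"
      using sl[OF S_E(2)[OF X]] by (auto simp: sl_def mtrace_smult)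
    ultimately show ?thesis
      unfolding S_def by blast
  qed
  have S_bracket: "lie_bracket X Y \<in> S" if X: "X \<in> S" and Y: "Y \<in> S" for X Y
  proof (rule S_I)
    obtain s t where st: "X + s \<cdot>\<^sub>m 1\<^sub>m n \<in> T" "Y + t \<cdot>\<^sub>m 1\<^sub>m n \<in> T"
      using S_E(1)[OF X] S_E(1)[OF Y] by blast
    have "lie_bracket X Y = lie_bracket (X + s \<cdot>\<^sub>m 1\<^sub>m n) (Y + t \<cdot>\<^sub>m 1\<^sub>m n)"
      using S_E(3)[OF X] S_E(3)[OF Y] by (simp add: lie_bracket_shift)
    also have "\<dots> \<in> T"
      unfolding lie_bracket_def by (intro T_diff T_mult st)
    finally show "lie_bracket X Y \<in> T" .
  qed (rule lie_bracket_in_sl[OF S_E(3)[OF X] S_E(3)[OF Y]])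
  have S_h: "lie_bracket h X \<in> S" if X: "X \<in> S" for X
  proof (rule S_I)
    obtain s where s: "X + s \<cdot>\<^sub>m 1\<^sub>m n \<in> T"
      using S_E(1)[OF X] by blast
    have "lie_bracket h X = lie_bracket h (X + s \<cdot>\<^sub>m 1\<^sub>m n)"
      using S_E(3)[OF X] h by (simp add: lie_bracket_shift)
    also have "\<dots> \<in> T"
      unfolding lie_bracket_def by (rule T_h[OF s])
    finally show "lie_bracket h X \<in> T" .
  qed (rule lie_bracket_in_sl[OF h S_E(3)[OF X]])
  have zero_S: "0\<^sub>m n n \<in> S"
    by (rule S_I) (use T(2) in \<open>auto simp: sl_def mtrace_def\<close>)
  have central: "lie_bracket X e = 0\<^sub>m n n \<longleftrightarrow> X * e = e * X" if "X \<in> carrier_mat n n" for X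
  proof -
    have dims: "X * e \<in> carrier_mat n n" "e * X \<in> carrier_mat n n"
      using that e by auto
    show ?thesis
    proof
      assume eq: "lie_bracket X e = 0\<^sub>m n n"
      have "X * e = (X * e - e * X) + e * X"
        using that e by (intro eq_matI) auto
      then show "X * e = e * X"
        using eq dims by (simp add: lie_bracket_def)
    qed (use dims in \<open>simp add: lie_bracket_def\<close>)
  qed
  have trivial: "X = 0\<^sub>m n n" if "X \<in> S" "X \<in> centralizer n e" for X
  proof -
    have X: "X \<in> carrier_mat n n" "mtrace X = 0"
      using sl[OF S_E(2)[OF that(1)]] .
    obtain t where t: "X + t \<cdot>\<^sub>m 1\<^sub>m n \<in> T"
      using S_E(1)[OF \<open>X \<in> S\<close>] by blast
    have "X * e = e * X"
      using that(2) central[OF X(1)] by (auto simp: centralizer_def)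
    then have "X + t \<cdot>\<^sub>m 1\<^sub>m n = 0\<^sub>m n n"
      using X(1) e by (intro T_unique[OF t]) (simp add: mult_shift)
    \<comment> \<open>The trace determines the scalar: \<open>t * n = 0\<close> gives
      \<open>t = 0\<close> unless the matrices are empty.\<close>
    moreover have "mtrace (X + t \<cdot>\<^sub>m 1\<^sub>m n) = t * of_nat n"
      using X mtrace_add[OF X(1), of "t \<cdot>\<^sub>m 1\<^sub>m n"] by (simp add: mtrace_smult[of _ n] mtrace_one)
    ultimately have "t * of_nat n = 0"
      by (simp add: mtrace_def)
    then consider "n = 0" | "t = 0" by auto
    then show ?thesis
    proof cases
      case 1
      then show ?thesis using X(1) by (intro eq_matI) auto
    next
      case 2
      then show ?thesis
        using add0[OF X(1)] \<open>X + t \<cdot>\<^sub>m 1\<^sub>m n = 0\<^sub>m n n\<close> by simp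
    qed
  qed
  have ex: "\<exists>C Y. C \<in> centralizer n e \<and> Y \<in> S \<and> X = C + Y" if "X \<in> sl n" for X
  proof -
    note X = sl[OF that]
    obtain C where C: "C \<in> carrier_mat n n" "C * e = e * C" "X - C \<in> T"
      using T_ex[OF X(1)] by blast
    \<comment> \<open>Subtracting the mean of the diagonal makes \<open>C\<close> traceless. For
      \<open>n = 0\<close> the quotient is 0 by convention and the trace is an empty sum.\<close>
    define s where "s = - (mtrace C / of_nat n)"
    let ?C = "C + s \<cdot>\<^sub>m 1\<^sub>m n" and ?Y = "X - C + (- s) \<cdot>\<^sub>m 1\<^sub>m n"
    have tr: "mtrace ?C = 0"
    proof -
      have "mtrace ?C = mtrace C + s * of_nat n"
        using C(1) mtrace_add[OF C(1), of "s \<cdot>\<^sub>m 1\<^sub>m n"] by (simp add: mtrace_smult[of _ n] mtrace_one)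
      also have "\<dots> = 0"
        using C(1) by (cases "n = 0") (auto simp: s_def mtrace_def)
      finally show ?thesis .
    qed
    have sum: "X = ?C + ?Y"
      using C(1) X(1) by (intro eq_matI) auto
    have carrier: "?C \<in> carrier_mat n n" "?Y \<in> carrier_mat n n"
      using C(1) X(1) by auto
    have "mtrace ?Y = 0"
      using mtrace_add[OF carrier] tr X(2) sum by simp
    moreover have "?Y + s \<cdot>\<^sub>m 1\<^sub>m n = X - C"
      using C(1) X(1) by (intro eq_matI) auto
    ultimately have "?Y \<in> S"
      unfolding S_def sl_def using carrier(2) C(3) by (metis (mono_tags, lifting) mem_Collect_eq)
    moreover have "?C * e = e * ?C"
      using C e by (simp add: mult_shift)
    then have "?C \<in> centralizer n e"
      using carrier(1) tr central[OF carrier(1)] by (simp add: centralizer_def sl_def)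
    ultimately show ?thesis
      using sum by blast
  qed
  have "direct_sum_decomp n (centralizer n e) S"
    unfolding direct_sum_decomp_def
  proof
    fix X assume "X \<in> sl n"
    then obtain C Y where CY: "C \<in> centralizer n e" "Y \<in> S" "X = C + Y"
      using ex by blast
    show "\<exists>!p. fst p \<in> centralizer n e \<and> snd p \<in> S \<and> X = fst p + snd p"
    proof (rule ex1I[of _ "(C, Y)"])
      fix p assume p: "fst p \<in> centralizer n e \<and> snd p \<in> S \<and> X = fst p + snd p"
      obtain C' Y' where p': "p = (C', Y')" by (cases p)
      have C: "C \<in> carrier_mat n n" "C * e = e * C" "C' \<in> carrier_mat n n" "C' * e = e * C'"
        "mtrace C = 0" "mtrace C' = 0"
        using CY(1) p central[of C] central[of C'] by (auto simp: p' centralizer_def sl_def)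
      have Y: "Y \<in> carrier_mat n n" "Y' \<in> S" "Y' \<in> carrier_mat n n"
        using S_E(3)[OF CY(2)] S_E(3)[of Y'] p by (auto simp: p')
      have eq: "C + Y = C' + Y'"
        using CY(3) p p' by simp
      have entry: "C $$ (i, j) + Y $$ (i, j) = C' $$ (i, j) + Y' $$ (i, j)" if "i < n" "j < n" for i j
        using arg_cong[OF eq, of "\<lambda>M. M $$ (i, j)"] that C Y by simp
      have diff: "C - C' = Y' + (- 1) \<cdot>\<^sub>m Y"
        using C Y entry by (intro eq_matI) (auto simp: algebra_simps)
      have "C - C' \<in> S"
        unfolding diff by (intro S_add S_smult CY(2) Y(2))
      moreover have "(C - C') * e = e * (C - C')"
        using C e by (simp add: minus_mult_distrib_mat[of _ n n _ _ n] mult_minus_distrib_mat[of _ n n _ n])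
      then have "C - C' \<in> centralizer n e"
        using C central[of "C - C'"] by (simp add: centralizer_def sl_def minus_carrier_mat mtrace_minus)
      ultimately have zero: "C - C' = 0\<^sub>m n n"
        by (rule trivial)
      have "C $$ (i, j) = C' $$ (i, j)" if "i < n" "j < n" for i j
        using arg_cong[OF zero, of "\<lambda>M. M $$ (i, j)"] that C by simp
      then have "C = C'"
        using C by (intro eq_matI) auto
      moreover have "Y = Y'"
        using entry Y \<open>C = C'\<close> by (intro eq_matI) auto
      ultimately show "p = (C, Y)"
        using p' by simp
    qed (use CY in simp)
  qed
  moreover have "lie_subalgebra n S"
    unfolding lie_subalgebra_def using zero_S S_add S_smult S_bracket S_E(2) by auto
  ultimately show ?thesis
    using S_h by blast
qed

theorem theorem3p4:
  fixes n :: nat and e h f :: "complex mat" and n_as :: "(nat \<times> complex) list"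
  assumes "e \<in> sl n"
    and "nilpotent_mat e"
    and "jordan_nf e n_as"
    and "\<forall>p\<in>fst ` set n_as. \<forall>q\<in>fst ` set n_as. p \<le> q + 1"
    and "sl2_triple n h e f"
  shows "\<exists>S. lie_subalgebra n S
           \<and> (\<forall>X\<in>S. lie_bracket h X \<in> S)
           \<and> direct_sum_decomp n (centralizer n e) S"
proof -
  have carrier: "h \<in> carrier_mat n n" "e \<in> carrier_mat n n" "f \<in> carrier_mat n n"
    using assms(5) by (auto simp: sl2_triple_def sl_def)
  have "2 \<cdot>\<^sub>m e = e + e" "(- 2) \<cdot>\<^sub>m f = - (f + f)"
    using carrier by (auto intro!: eq_matI)
  then have triple: "h * e - e * h = e + e" "h * f - f * h = - (f + f)" "e * f - f * e = h"
    using assms(5) by (auto simp: sl2_triple_def lie_bracket_def)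
  obtain d a b where d: "e ^\<^sub>m Suc d = 0\<^sub>m n n" "a \<in> carrier_mat n n" "b \<in> carrier_mat n n"
    "e * a + b * e ^\<^sub>m (d - 1) = 1\<^sub>m n"
    using jordan_nf_unit[OF carrier(2) assms(2-4)] by blast
  show ?thesis
    by (rule centralizer_complement_mat[OF carrier d(2,3) triple d(1,4)])
      (rule sl_complement[OF carrier(1,2)])
qed

end
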